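(* Let $\mathcal{T}\in\mathbb{R}^{I\times J\times K}$, and let $$f:S^{J-1}\times S^{K-1}\to\mathbb{R},\qquad f(\mathbf{b},\mathbf{c})=\sum_{\alpha,\beta,\gamma,\delta}\mathcal{M}_{\alpha\beta\gamma\delta}\,b_\alpha c_\beta b_\gamma c_\delta .$$ If the extrema of $f$ are nondegenerate, then there always exists a set of vectors $(\mathbf{a},\mathbf{b},\mathbf{c})\in\mathbb{R}^I\times\mathbb{R}^J\times\mathbb{R}^K$ which is neither a maximum nor a minimum of the rank-one least squares functional $$(\mathbf{a},\mathbf{b},\mathbf{c})\mapsto\tfrac12\|\mathcal{T}-\mathbf{a}\circ\mathbf{b}\circ\mathbf{c}\|_F^2$$ and for which the ALS sequence for minimizing this functional remains constant at this point: $$(\mathbf{a}_{k+1},\mathbf{b}_{k+1},\mathbf{c}_{k+1})=(\mathbf{a}_k,\mathbf{b}_k,\mathbf{c}_k)\qquad\forall k\ge1.$$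
   Context: $S^n=\{\mathbf{x}\in\mathbb{R}^{n+1}:\|\mathbf{x}\|=1\}$, $(\mathbf{a}\circ\mathbf{b}\circ\mathbf{c})_{ijk}=a_ib_jc_k$, and $\|\cdot\|_F$ is the Frobenius norm. $\mathcal{M}_{\alpha\beta\gamma\delta}=\sum_{i=1}^I\mathcal{T}_{i\alpha\beta}\mathcal{T}_{i\gamma\delta}$. The extrema of $f$ are its maxima and minima; they are nondegenerate if the Hessian of $f$, as a smooth function on the manifold $S^{J-1}\times S^{K-1}$, is non-singular at these points. The rank-one alternating least-squares (ALS) iteration is $$\mathbf{a}_{k+1}=\frac{\mathcal{T}(\cdot,\mathbf{b}_k,\mathbf{c}_k)}{\|\mathbf{b}_k\|^2\|\mathbf{c}_k\|^2},\quad \mathbf{b}_{k+1}=\frac{\mathcal{T}(\mathbf{a}_{k+1},\cdot,\mathbf{c}_k)}{\|\mathbf{a}_{k+1}\|^2\|\mathbf{c}_k\|^2},\quad \mathbf{c}_{k+1}=\frac{\mathcal{T}(\mathbf{a}_{k+1},\mathbf{b}_{k+1},\cdot)}{\|\mathbf{a}_{k+1}\|^2\|\mathbf{b}_{k+1}\|^2},$$ where $\mathcal{T}(\cdot,\mathbf{b},\mathbf{c})_i=\sum_{j,k}\mathcal{T}_{ijk}b_jc_k$, $\mathcal{T}(\mathbf{a},\cdot,\mathbf{c})_j=\sum_{i,k}\mathcal{T}_{ijk}a_ic_k$, $\mathcal{T}(\mathbf{a},\mathbf{b},\cdot)_k=\sum_{i,j}\mathcal{T}_{ijk}a_ib_j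$.
   Formalization: The condition J+K ≥ 4 is added: for (J,K) = (1,1), (1,2), (2,1) the claim fails, e.g. I=J=1, K=2, T=(1,0) has nondegenerate extrema, but every well-defined ALS fixed point is a global minimum. *)

theory Defs
  imports "HOL-Analysis.Analysis"
begin

type_synonym ('i, 'j, 'k) tensor = "real ^ 'k ^ 'j ^ 'i"

definition outer3 ::
  "real ^ 'i \<Rightarrow> real ^ 'j \<Rightarrow> real ^ 'k \<Rightarrow> ('i::finite, 'j::finite, 'k::finite) tensor" where
  "outer3 a b c = (\<chi> i j k. a $ i * b $ j * c $ k)"

text \<open>The library norm on the nested vector type is the iterated Euclidean norm, that is,
  the square root of the sum of the squares of all entries: the Frobenius norm.\<close>

definition ls_functional ::
  "('i::finite, 'j::finite, 'k::finite) tensor \<Rightarrow> (real ^ 'i) \<times> (real ^ 'j) \<times> (real ^ 'k) \<Rightarrow> real" where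
  "ls_functional T = (\<lambda>(a, b, c). (norm (T - outer3 a b c))\<^sup>2 / 2)"

definition contract1 ::
  "('i::finite, 'j::finite, 'k::finite) tensor \<Rightarrow> real ^ 'j \<Rightarrow> real ^ 'k \<Rightarrow> real ^ 'i" where
  "contract1 T b c = (\<chi> i. \<Sum>j\<in>UNIV. \<Sum>k\<in>UNIV. T $ i $ j $ k * b $ j * c $ k)"

definition contract2 ::
  "('i::finite, 'j::finite, 'k::finite) tensor \<Rightarrow> real ^ 'i \<Rightarrow> real ^ 'k \<Rightarrow> real ^ 'j" where
  "contract2 T a c = (\<chi> j. \<Sum>i\<in>UNIV. \<Sum>k\<in>UNIV. T $ i $ j $ k * a $ i * c $ k)"

definition contract3 ::
  "('i::finite, 'j::finite, 'k::finite) tensor \<Rightarrow> real ^ 'i \<Rightarrow> real ^ 'j \<Rightarrow> real ^ 'k" where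
  "contract3 T a b = (\<chi> k. \<Sum>i\<in>UNIV. \<Sum>j\<in>UNIV. T $ i $ j $ k * a $ i * b $ j)"

text \<open>If one of the denominators vanishes, the step is mathematically undefined, whereas
  the total division of HOL returns the zero vector. Statements about the iteration
  therefore have to ask separately for nonzero vectors; otherwise \<open>(0, 0, 0)\<close> would be a
  spurious fixed point.\<close>

definition als_step ::
  "('i::finite, 'j::finite, 'k::finite) tensor \<Rightarrow>
    (real ^ 'i) \<times> (real ^ 'j) \<times> (real ^ 'k) \<Rightarrow> (real ^ 'i) \<times> (real ^ 'j) \<times> (real ^ 'k)" where
  "als_step T = (\<lambda>(a, b, c).
     let a' = contract1 T b c /\<^sub>R ((norm b)\<^sup>2 * (norm c)\<^sup>2);
         b' = contract2 T a' c /\<^sub>R ((norm a')\<^sup>2 * (norm c)\<^sup>2);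
         c' = contract3 T a' b' /\<^sub>R ((norm a')\<^sup>2 * (norm b')\<^sup>2)
     in (a', b', c'))"

definition als_seq ::
  "('i::finite, 'j::finite, 'k::finite) tensor \<Rightarrow>
    (real ^ 'i) \<times> (real ^ 'j) \<times> (real ^ 'k) \<Rightarrow> nat \<Rightarrow> (real ^ 'i) \<times> (real ^ 'j) \<times> (real ^ 'k)" where
  "als_seq T x n = (als_step T ^^ n) x"

definition tensor_M ::
  "('i::finite, 'j::finite, 'k::finite) tensor \<Rightarrow> 'j \<Rightarrow> 'k \<Rightarrow> 'j \<Rightarrow> 'k \<Rightarrow> real" where
  "tensor_M T \<alpha> \<beta> \<gamma> \<delta> = (\<Sum>i\<in>UNIV. T $ i $ \<alpha> $ \<beta> * T $ i $ \<gamma> $ \<delta>)"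

definition quartic_form ::
  "('i::finite, 'j::finite, 'k::finite) tensor \<Rightarrow> (real ^ 'j) \<times> (real ^ 'k) \<Rightarrow> real" where
  "quartic_form T = (\<lambda>(b, c). \<Sum>\<alpha>\<in>UNIV. \<Sum>\<beta>\<in>UNIV. \<Sum>\<gamma>\<in>UNIV. \<Sum>\<delta>\<in>UNIV.
     tensor_M T \<alpha> \<beta> \<gamma> \<delta> * b $ \<alpha> * c $ \<beta> * b $ \<gamma> * c $ \<delta>)"

definition sphere_prod :: "('a::euclidean_space \<times> 'b::euclidean_space) set" where
  "sphere_prod = sphere 0 1 \<times> sphere 0 1"

definition sphere_prod_tangent ::
  "'a::euclidean_space \<times> 'b::euclidean_space \<Rightarrow> ('a \<times> 'b) set" where
  "sphere_prod_tangent p = {(u, v). u \<bullet> fst p = 0 \<and> v \<bullet> snd p = 0}"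

text \<open>For a unit vector \<open>b\<close> and \<open>u\<close> orthogonal to \<open>b\<close>, this is the geodesic of the unit
  sphere with position \<open>b\<close> and velocity \<open>u\<close> at time \<open>0\<close> (constant if \<open>u = 0\<close>).
  Recall \<open>sgn u = u / norm u\<close> and \<open>sgn 0 = 0\<close>.\<close>

definition great_circle :: "'a::euclidean_space \<Rightarrow> 'a \<Rightarrow> real \<Rightarrow> 'a" where
  "great_circle b u t = cos (t * norm u) *\<^sub>R b + sin (t * norm u) *\<^sub>R sgn u"

text \<open>The Riemannian Hessian of a smooth function \<open>g\<close> at \<open>p\<close> is the symmetric bilinear form
  on the tangent space whose value at \<open>(\<xi>, \<xi>)\<close> is the second derivative at \<open>0\<close> of \<open>g\<close>
  along the geodesic with initial velocity \<open>\<xi>\<close>; the geodesics of a product are the pairs of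
  geodesics of the factors. Equivalently, it is the ordinary Hessian of \<open>g\<close> at \<open>p\<close> in normal
  coordinates. At critical points, it agrees with the coordinate-free Hessian, which needs
  no metric. Only the values of \<open>g\<close> on \<open>sphere_prod\<close> enter.\<close>

definition hessian_quad ::
  "('a::euclidean_space \<times> 'b::euclidean_space \<Rightarrow> real) \<Rightarrow> 'a \<times> 'b \<Rightarrow> 'a \<times> 'b \<Rightarrow> real" where
  "hessian_quad g p \<xi> =
     (deriv ^^ 2) (\<lambda>t. g (great_circle (fst p) (fst \<xi>) t, great_circle (snd p) (snd \<xi>) t)) 0"

definition hessian ::
  "('a::euclidean_space \<times> 'b::euclidean_space \<Rightarrow> real) \<Rightarrow> 'a \<times> 'b \<Rightarrow> 'a \<times> 'b \<Rightarrow> 'a \<times> 'b \<Rightarrow> real" where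
  "hessian g p \<xi> \<eta> = (hessian_quad g p (\<xi> + \<eta>) - hessian_quad g p (\<xi> - \<eta>)) / 4"

definition hessian_nonsingular ::
  "('a::euclidean_space \<times> 'b::euclidean_space \<Rightarrow> real) \<Rightarrow> 'a \<times> 'b \<Rightarrow> bool" where
  "hessian_nonsingular g p \<longleftrightarrow>
     (\<forall>\<xi>\<in>sphere_prod_tangent p.
        (\<forall>\<eta>\<in>sphere_prod_tangent p. hessian g p \<xi> \<eta> = 0) \<longrightarrow> \<xi> = 0)"

text \<open>Maxima and minima of a function on a set are taken to be global here, and local in
  the two definitions after it. Assuming nondegeneracy only of the global extrema and
  excluding even local extrema covers both readings of the words.\<close>

definition extremum_on :: "('a \<Rightarrow> real) \<Rightarrow> 'a set \<Rightarrow> 'a \<Rightarrow> bool" where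
  "extremum_on g S p \<longleftrightarrow> p \<in> S \<and> ((\<forall>q\<in>S. g q \<le> g p) \<or> (\<forall>q\<in>S. g p \<le> g q))"

definition local_max :: "('a::topological_space \<Rightarrow> real) \<Rightarrow> 'a \<Rightarrow> bool" where
  "local_max g x \<longleftrightarrow> (\<forall>\<^sub>F y in nhds x. g y \<le> g x)"

definition local_min :: "('a::topological_space \<Rightarrow> real) \<Rightarrow> 'a \<Rightarrow> bool" where
  "local_min g x \<longleftrightarrow> (\<forall>\<^sub>F y in nhds x. g x \<le> g y)"

end

theory Submission
  imports Defs
begin

text \<open>Write \<open>S b c\<close> for the contraction \<open>T(\<cdot>, b, c)\<close>, so that \<open>f (b, c) = \<parallel>S b c\<parallel>\<^sup>2\<close>. For unit vectors \<open>b\<close>, \<open>c\<close>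
  the best choice of \<open>a\<close> is \<open>S b c\<close>, and the least squares functional then equals
  \<open>(\<parallel>T\<parallel>\<^sup>2 - f (b, c)) / 2\<close>. Hence, if \<open>(b, c)\<close> is a critical point of \<open>f\<close> on the product of
  spheres with \<open>f (b, c) > 0\<close> that is not a local maximum of \<open>f\<close>, then \<open>(S b c, b, c)\<close> is a fixed
  point of the ALS step and not a local minimum of the functional. It is never a local maximum,
  because the functional is a strictly convex quadratic polynomial along \<open>t \<mapsto> (t a, b, c)\<close>.

  Such a critical point comes from a mountain pass argument. Let \<open>p = (b, c)\<close> be a global maximum
  of \<open>f\<close>. As \<open>f\<close> is even in each argument, \<open>(- b, c)\<close> and \<open>(b, - c)\<close> are global maxima, too. By
  nondegeneracy, \<open>p\<close> is an isolated maximum and the zeros of \<open>f\<close>, which are global minima, are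
  isolated, hence finite in number (\<open>nondegenerate_extremum_isolated\<close>). As the product of the
  spheres has dimension at least two, \<open>p\<close> can be joined to one of the two other maxima by a curve
  that avoids the zeros of \<open>f\<close> (\<open>antipodal_continuum\<close>). Therefore the highest level \<open>c\<^sub>0\<close> at which
  \<open>p\<close> and the other maximum lie in one continuum contained in \<open>{f \<ge> c\<^sub>0}\<close> is positive.

  No gradient flow is needed to find a critical point at the level \<open>c\<^sub>0\<close>: the alternating power
  iteration \<open>b' \<sim> b + S\<^sup>T S b\<close>, \<open>c' \<sim> c + S\<^sup>T S c\<close> is a continuous map \<open>\<Phi>\<close> of the product of spheres that
  strictly increases \<open>f\<close> except at its fixed points, and these are critical (\<open>rayleigh_ascent\<close>).
  Let \<open>C\<close> be a continuum through both maxima on which \<open>f \<ge> c\<^sub>0\<close>. If all fixed points at the level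
  \<open>c\<^sub>0\<close> were local maxima, those in \<open>C\<close> would form a subset that is both open and closed in \<open>C\<close>,
  hence empty, since \<open>f\<close> is not constant on \<open>C\<close>, where \<open>p\<close> is an isolated maximum. Then \<open>f > c\<^sub>0\<close> on the continuum \<open>\<Phi> ` C\<close>, which contradicts the choice
  of \<open>c\<^sub>0\<close> (\<open>mountain_pass\<close>).\<close>

section \<open>Ascent by a shifted power iteration\<close>

text \<open>If \<open>M\<close> is the adjoint of \<open>L\<close>, then \<open>w = M (L x)\<close>, and \<open>x \<mapsto> x + s w\<close> is a step of the power
  iteration for \<open>1 + s M L\<close>. It increases the Rayleigh quotient of \<open>M L\<close> strictly unless \<open>x\<close> is an
  eigenvector. The shift by the identity keeps the step defined where \<open>L x = 0\<close>, and
  for small \<open>s\<close> the new point is close to \<open>x\<close>.\<close>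

lemma rayleigh_ascent:
  fixes L :: "'x::real_inner \<Rightarrow> 'y::real_inner"
  assumes L: "linear L" and adj: "\<And>x a. L x \<bullet> a = x \<bullet> M a"
    and x: "norm x = 1" and s: "s > 0"
  defines "w \<equiv> M (L x)"
  shows "x + s *\<^sub>R w \<noteq> 0"
    and "w \<noteq> (norm (L x))\<^sup>2 *\<^sub>R x \<Longrightarrow> (norm (L x))\<^sup>2 < (norm (L (sgn (x + s *\<^sub>R w))))\<^sup>2"
    and "w = (norm (L x))\<^sup>2 *\<^sub>R x \<Longrightarrow> sgn (x + s *\<^sub>R w) = x"
proof -
  define y where "y = x + s *\<^sub>R w"
  define m1 m2 m3 where "m1 = (norm (L x))\<^sup>2" and "m2 = (norm w)\<^sup>2" and "m3 = (norm (L w))\<^sup>2"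
  have xx: "x \<bullet> x = 1" using x by (simp add: norm_eq_1)
  have xw: "x \<bullet> w = m1" unfolding m1_def w_def adj[symmetric] by (simp add: power2_norm_eq_inner)
  have Lw: "L w \<bullet> L x = m2"
    unfolding m2_def w_def adj by (simp add: power2_norm_eq_inner)
  have y2: "(norm y)\<^sup>2 = 1 + 2 * s * m1 + s\<^sup>2 * m2"
    unfolding y_def power2_norm_eq_inner m2_def
    by (simp add: inner_simps xx xw inner_commute[of w x] power2_eq_square algebra_simps)
  have Ly: "(norm (L y))\<^sup>2 = m1 + 2 * s * m2 + s\<^sup>2 * m3"
    unfolding y_def m1_def m3_def power2_norm_eq_inner
    by (simp add: linear_add[OF L] linear_cmul[OF L] inner_simps Lw inner_commute[of "L x" "L w"]
        power2_eq_square algebra_simps)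
  have d: "m2 - m1\<^sup>2 = (norm (w - m1 *\<^sub>R x))\<^sup>2"
    unfolding m2_def power2_norm_eq_inner
    by (simp add: inner_simps xx xw inner_commute[of w x] power2_eq_square algebra_simps)
  have m1: "0 \<le> m1" and m2: "0 \<le> m2" and m3: "0 \<le> m3" by (auto simp: m1_def m2_def m3_def)
  have cs: "m2\<^sup>2 \<le> m3 * m1"
    using Cauchy_Schwarz_ineq[of "L w" "L x"]
    by (simp add: Lw m1_def m3_def power2_norm_eq_inner)
  have d0: "m1\<^sup>2 \<le> m2" using d by (metis diff_ge_0_iff_ge zero_le_power2)
  have "m1 * m2 \<le> m3"
  proof (cases "m1 = 0")
    case False
    have "m1 * (m1 * m2) \<le> m1 * m3"
      using mult_right_mono[OF d0 m2] cs by (simp add: power2_eq_square ac_simps)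
    with False m1 show ?thesis by simp
  qed (use m3 in simp)
  then have s3: "0 \<le> s\<^sup>2 * (m3 - m1 * m2)" by simp
  have y0: "0 < (norm y)\<^sup>2" unfolding y2 using s m1 m2
    by (intro add_pos_nonneg mult_nonneg_nonneg) auto
  show nz: "x + s *\<^sub>R w \<noteq> 0" using y0 by (auto simp: y_def)
  have sg: "(norm (L (sgn y)))\<^sup>2 = (norm (L y))\<^sup>2 / (norm y)\<^sup>2"
    by (simp add: sgn_div_norm linear_cmul[OF L] power_mult_distrib power_inverse divide_inverse mult.commute)
  show "(norm (L x))\<^sup>2 < (norm (L (sgn (x + s *\<^sub>R w))))\<^sup>2" if "w \<noteq> (norm (L x))\<^sup>2 *\<^sub>R x"
  proof -
    have "0 < m2 - m1\<^sup>2" unfolding d using that by (simp add: m1_def)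
    then have "0 < 2 * s * (m2 - m1\<^sup>2)" using s by simp
    then have "m1 * (norm y)\<^sup>2 < (norm (L y))\<^sup>2"
      using s3 unfolding y2 Ly by (simp add: algebra_simps power2_eq_square)
    then show ?thesis unfolding y_def[symmetric] m1_def[symmetric] sg using y0
      by (simp add: pos_less_divide_eq)
  qed
  show "sgn (x + s *\<^sub>R w) = x" if e: "w = (norm (L x))\<^sup>2 *\<^sub>R x"
  proof -
    have "x + s *\<^sub>R w = (1 + s * m1) *\<^sub>R x" by (subst e) (simp add: m1_def algebra_simps)
    moreover have "0 < 1 + s * m1" using s m1 by (intro add_pos_nonneg mult_nonneg_nonneg) auto
    ultimately show ?thesis using x by (simp add: sgn_div_norm)
  qed
qed

section \<open>A mountain pass theorem for an ascent map\<close>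

text \<open>The points \<open>p\<close> and \<open>p'\<close> are maximum points, \<open>p\<close> being isolated among them, and \<open>d\<close> is a lower
  bound of \<open>f\<close> on one continuum through both. The conclusion is a fixed point of the ascent map
  at a level of at least \<open>d\<close> that is not a local maximum.\<close>

lemma mountain_pass:
  fixes f :: "'a::euclidean_space \<Rightarrow> real" and \<Phi> :: "'a \<Rightarrow> 'a"
  assumes M: "compact M" and f: "continuous_on M f" and \<Phi>: "continuous_on M \<Phi>" "\<Phi> ` M \<subseteq> M"
    and ascent: "\<And>x. x \<in> M \<Longrightarrow> \<Phi> x \<noteq> x \<Longrightarrow> f x < f (\<Phi> x)"
    and stationary: "\<And>x e. x \<in> M \<Longrightarrow> e > 0 \<Longrightarrow> (\<And>y. y \<in> M \<Longrightarrow> dist y x < e \<Longrightarrow> f y \<le> f x) \<Longrightarrow> \<Phi> x = x"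
    and max: "\<And>x. x \<in> M \<Longrightarrow> f x \<le> f p" and ff: "f p' = f p" and ne: "p \<noteq> p'"
    and iso: "e > 0" "\<And>x. x \<in> M \<Longrightarrow> dist x p < e \<Longrightarrow> f x = f p \<Longrightarrow> x = p"
    and C0: "compact C0" "connected C0" "C0 \<subseteq> M" "p \<in> C0" "p' \<in> C0" "\<And>x. x \<in> C0 \<Longrightarrow> d \<le> f x"
  shows "\<exists>q\<in>M. \<Phi> q = q \<and> d \<le> f q \<and> (\<forall>e>0. \<exists>y\<in>M. dist y q < e \<and> f q < f y)"
proof (rule ccontr)
  assume contr: "\<not> ?thesis"
  have lm: "\<exists>e>0. \<forall>y\<in>M. dist y q < e \<longrightarrow> f y \<le> f q" if "q \<in> M" "\<Phi> q = q" "d \<le> f q" for q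
    using contr that by (meson not_le)
  define A where "A = {t. \<exists>C. compact C \<and> connected C \<and> C \<subseteq> M \<and> p \<in> C \<and> p' \<in> C \<and> (\<forall>x\<in>C. t \<le> f x)}"
  define c where "c = Sup A"
  have dA: "d \<in> A" using C0 by (auto simp: A_def)
  have bdd: "bdd_above A" unfolding A_def by (rule bdd_aboveI[of _ "f p"]) auto
  have dc: "d \<le> c" unfolding c_def by (rule cSup_upper[OF dA bdd])
  have pM: "p \<in> M" "p' \<in> M" using C0 by auto
  have fix_max: "\<Phi> p = p" "\<Phi> p' = p'"
    using ascent[of p] ascent[of p'] max[of "\<Phi> p"] max[of "\<Phi> p'"] ff pM \<Phi>(2) by force+
  \<comment> \<open>A continuum at the optimal level itself is the intersection of the components of \<open>p\<close> in
    the superlevel sets slightly below; nested intersections of continua are connected.\<close>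
  define S where "S n = {x \<in> M. c - 1 / real (Suc n) \<le> f x}" for n
  define K where "K n = connected_component_set (S n) p" for n
  have Scomp: "compact (S n)" for n
  proof -
    have "closedin (top_of_set M) (M \<inter> f -` {c - 1 / real (Suc n)..})"
      by (rule continuous_closedin_preimage[OF f]) simp
    moreover have "S n = M \<inter> f -` {c - 1 / real (Suc n)..}" by (auto simp: S_def)
    ultimately show ?thesis using M closedin_compact by metis
  qed
  have Kcomp: "compact (K n)" for n
    unfolding K_def by (metis Scomp closed_connected_component compact_eq_bounded_closed bounded_subset connected_component_subset)
  have Kconn: "connected (K n)" for n unfolding K_def by simp
  have Kp: "p \<in> K n" "p' \<in> K n" for n
  proof -
    have "c - 1 / real (Suc n) < c" by simp
    then obtain t where t: "t \<in> A" "c - 1 / real (Suc n) < t"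
      unfolding c_def using less_cSup_iff[OF _ bdd] dA by blast
    then obtain C where C: "connected C" "C \<subseteq> M" "p \<in> C" "p' \<in> C" "\<forall>x\<in>C. t \<le> f x"
      unfolding A_def by auto
    then have "C \<subseteq> S n" using t by (force simp: S_def)
    then have "C \<subseteq> K n" unfolding K_def using C by (intro connected_component_maximal)
    then show "p \<in> K n" "p' \<in> K n" using C by auto
  qed
  have Kanti: "K n \<subseteq> K m" if "m \<le> n" for m n
  proof -
    have "1 / real (Suc n) \<le> 1 / real (Suc m)" using that by (simp add: field_simps)
    then have "S n \<subseteq> S m" by (auto simp: S_def)
    then show ?thesis unfolding K_def by (rule connected_component_mono)
  qed
  define C where "C = \<Inter>(range K)"
  have C: "connected C" unfolding C_def by (rule connected_nest[OF Kcomp Kconn Kanti])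
  have Ccomp: "compact C" unfolding C_def using Kcomp by (intro compact_Inter) auto
  have pC: "p \<in> C" "p' \<in> C" using Kp by (auto simp: C_def)
  have CS: "x \<in> S n" if "x \<in> C" for x n
    using that connected_component_subset[of "S n" p] by (auto simp: C_def K_def)
  then have CM: "C \<subseteq> M" by (auto simp: S_def)
  have Cf: "c \<le> f x" if "x \<in> C" for x
  proof (rule field_le_epsilon)
    fix e :: real assume "e > 0"
    then obtain n where "1 / real (Suc n) < e" using nat_approx_posE by metis
    then show "c \<le> f x + e" using CS[OF that, of n] by (auto simp: S_def)
  qed
  \<comment> \<open>Near a local maximum at level \<open>c\<close>, the function is constant on \<open>C\<close>, so that the nearby points
    of \<open>C\<close> are local maxima, too, and hence fixed.\<close>
  define Z where "Z = {x \<in> C. f x = c \<and> \<Phi> x = x}"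
  have fC: "continuous_on C f" and \<Phi>C: "continuous_on C \<Phi>"
    using f \<Phi>(1) CM continuous_on_subset by blast+
  have "closedin (top_of_set C) Z"
  proof -
    have "closedin (top_of_set C) (C \<inter> f -` {c})"
      by (rule continuous_closedin_preimage[OF fC]) simp
    moreover have "closedin (top_of_set C) (C \<inter> (\<lambda>x. \<Phi> x - x) -` {0})"
      by (rule continuous_closedin_preimage) (intro continuous_intros \<Phi>C, simp)
    moreover have "Z = (C \<inter> f -` {c}) \<inter> (C \<inter> (\<lambda>x. \<Phi> x - x) -` {0})" by (auto simp: Z_def)
    ultimately show ?thesis by (simp add: closedin_Int)
  qed
  moreover have "openin (top_of_set C) Z"
    unfolding openin_euclidean_subtopology_iff
  proof (intro conjI ballI)
    fix x assume x: "x \<in> Z"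
    then obtain e where e: "e > 0" "\<And>y. y \<in> M \<Longrightarrow> dist y x < e \<Longrightarrow> f y \<le> c"
      using lm[of x] CM dc by (auto simp: Z_def)
    have "y \<in> Z" if y: "y \<in> C" "dist y x < e" for y
    proof -
      have fy: "f y = c" using e(2)[of y] Cf[of y] y CM by fastforce
      have "\<Phi> y = y"
      proof (rule stationary)
        show "0 < e - dist y x" "y \<in> M" using y CM by auto
        fix z assume "z \<in> M" "dist z y < e - dist y x"
        then show "f z \<le> f y"
          unfolding fy using dist_triangle[of z x y] by (intro e(2)) auto
      qed
      with fy y show ?thesis by (simp add: Z_def)
    qed
    with e(1) show "\<exists>e>0. \<forall>x'\<in>C. dist x' x < e \<longrightarrow> x' \<in> Z" by blast
  qed (auto simp: Z_def)
  ultimately have "Z = {} \<or> Z = C"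
    using C unfolding connected_clopen by blast
  moreover have "Z \<noteq> C"
  proof
    assume "Z = C"
    then have fc: "f x = c" if "x \<in> C" for x using that Z_def by blast
    then have fp: "f x = f p" if "x \<in> C" for x using that pC(1) by simp
    have "x = p" if "x \<in> C" "x \<in> ball p e" for x
      using iso(2)[of x] fp[of x] CM that by (auto simp: dist_commute)
    then have "{p} = C \<inter> ball p e" using pC(1) iso(1) by force
    then have "openin (top_of_set C) {p}" by (metis open_ball openin_open_Int)
    moreover have "closedin (top_of_set C) {p}" using pC by (simp add: closed_subset)
    ultimately have "{p} = C" using C unfolding connected_clopen by blast
    with pC ne show False by auto
  qed
  ultimately have Z: "Z = {}" by blast
  \<comment> \<open>Without fixed points at level \<open>c\<close>, the ascent map pushes all of \<open>C\<close> above that level.\<close>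
  have gt: "c < f (\<Phi> x)" if x: "x \<in> C" for x
  proof (cases "\<Phi> x = x")
    case True
    then have "f x \<noteq> c" using Z x by (auto simp: Z_def)
    then show ?thesis using Cf[OF x] True by simp
  next
    case False
    then have "f x < f (\<Phi> x)" using ascent CM x by blast
    with Cf[OF x] show ?thesis by simp
  qed
  have imc: "compact (\<Phi> ` C)" by (rule compact_continuous_image[OF \<Phi>C Ccomp])
  have imM: "\<Phi> ` C \<subseteq> M" using \<Phi>(2) CM by blast
  obtain z where z: "z \<in> \<Phi> ` C" "\<forall>y\<in>\<Phi> ` C. f z \<le> f y"
    using continuous_attains_inf[OF imc _ continuous_on_subset[OF f imM]] pC by blast
  have "p \<in> \<Phi> ` C" "p' \<in> \<Phi> ` C" using pC fix_max by (metis imageI)+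
  then have "f z \<in> A"
    unfolding A_def using imc connected_continuous_image[OF \<Phi>C C] imM z(2) by blast
  then have "f z \<le> c" unfolding c_def by (rule cSup_upper[OF _ bdd])
  moreover obtain x where "x \<in> C" "z = \<Phi> x" using z(1) by blast
  ultimately show False using gt by force
qed

section \<open>Second order analysis at extrema\<close>

text \<open>The function \<open>\<beta>1\<close> is the velocity of the great circle.\<close>

lemma great_circle_derivs:
  fixes b u :: "'a::euclidean_space"
  defines "\<beta>1 \<equiv> \<lambda>t. cos (t * norm u) *\<^sub>R u - (norm u * sin (t * norm u)) *\<^sub>R b"
  shows "(great_circle b u has_vector_derivative \<beta>1 t) (at t)"
    and "(\<beta>1 has_vector_derivative (- (norm u)\<^sup>2) *\<^sub>R b) (at 0)"
    and "great_circle b u 0 = b"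
proof -
  have u: "norm u *\<^sub>R sgn u = u" by (cases "u = 0") (auto simp: sgn_div_norm)
  have "((\<lambda>t. cos (t * norm u) *\<^sub>R b + sin (t * norm u) *\<^sub>R sgn u) has_vector_derivative
     (- (sin (t * norm u) * norm u)) *\<^sub>R b + (cos (t * norm u) * norm u) *\<^sub>R sgn u) (at t)"
    by (auto intro!: derivative_eq_intros)
  moreover have "(- (sin (t * norm u) * norm u)) *\<^sub>R b + (cos (t * norm u) * norm u) *\<^sub>R sgn u = \<beta>1 t"
    unfolding \<beta>1_def by (metis (no_types, opaque_lifting) add.commute diff_conv_add_uminus mult.commute scaleR_minus_left scaleR_scaleR u)
  ultimately show "(great_circle b u has_vector_derivative \<beta>1 t) (at t)"
    by (simp add: great_circle_def[abs_def])
  show "(\<beta>1 has_vector_derivative (- (norm u)\<^sup>2) *\<^sub>R b) (at 0)"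
    unfolding \<beta>1_def by (auto intro!: derivative_eq_intros simp: power2_eq_square)
qed (auto simp: great_circle_def \<beta>1_def)

lemma quartic_nonpos_coeffs:
  fixes l q r s :: real
  assumes "\<And>t. l * t + q * t^2 + r * t^3 + s * t^4 \<le> 0"
  shows "l = 0" "q \<le> 0"
proof -
  have 1: "l + q * t + r * t^2 + s * t^3 \<le> 0" if "t > 0" for t
  proof -
    have "t * (l + q * t + r * t^2 + s * t^3) \<le> t * 0"
      using assms[of t] by (simp add: algebra_simps power2_eq_square power3_eq_cube power4_eq_xxxx)
    with that show ?thesis by (simp only: mult_le_cancel_left_pos)
  qed
  have 2: "l + q * t + r * t^2 + s * t^3 \<ge> 0" if "t < 0" for t
  proof -
    have "t * (l + q * t + r * t^2 + s * t^3) \<le> t * 0"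
      using assms[of t] by (simp add: algebra_simps power2_eq_square power3_eq_cube power4_eq_xxxx)
    with that show ?thesis by (simp only: mult_le_cancel_left_neg)
  qed
  have lim: "((\<lambda>t. l + q * t + r * t^2 + s * t^3) \<longlongrightarrow> l + q * 0 + r * 0^2 + s * 0^3) (at 0 within A)" for A
    by (intro tendsto_intros)
  have "l \<le> 0"
    using tendsto_upperbound[OF lim[of "{0<..}"]] 1 by (auto simp: eventually_at_filter)
  moreover have "0 \<le> l"
    using tendsto_lowerbound[OF lim[of "{..<0}"]] 2 by (auto simp: eventually_at_filter)
  ultimately show l: "l = 0" by simp
  have 3: "q + r * t + s * t^2 \<le> 0" if "t > 0" for t
  proof -
    have "t * (q + r * t + s * t^2) \<le> t * 0"
      using 1[OF that] l by (simp add: algebra_simps power2_eq_square power3_eq_cube)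
    with that show ?thesis by (simp only: mult_le_cancel_left_pos)
  qed
  have "((\<lambda>t. q + r * t + s * t^2) \<longlongrightarrow> q + r * 0 + s * 0^2) (at_right 0)"
    by (intro tendsto_intros)
  then show "q \<le> 0"
    using tendsto_upperbound[of "\<lambda>t. q + r * t + s * t^2" _ "at_right 0" 0] 3 by (auto simp: eventually_at_filter)
qed

text \<open>The three partial contractions of a tensor, as bilinear maps on abstract Euclidean spaces that
  are adjoint to each other: \<open>S\<close> contracts with \<open>b\<close> and \<open>c\<close>, \<open>S2\<close> with \<open>a\<close> and \<open>c\<close>, and \<open>S3\<close> with
  \<open>a\<close> and \<open>b\<close>.\<close>

locale trilinear_contractions =
  fixes S :: "'b::euclidean_space \<Rightarrow> 'c::euclidean_space \<Rightarrow> 'a::euclidean_space"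
    and S2 :: "'a \<Rightarrow> 'c \<Rightarrow> 'b" and S3 :: "'a \<Rightarrow> 'b \<Rightarrow> 'c"
  assumes bil: "bounded_bilinear S" and bil2: "bounded_bilinear S2" and bil3: "bounded_bilinear S3"
    and adj2: "S b c \<bullet> a = b \<bullet> S2 a c" and adj3: "S b c \<bullet> a = c \<bullet> S3 a b"
begin

text \<open>The function whose restriction to the product of spheres is studied; for the contractions of a tensor it is the quartic form.\<close>

definition energy :: "'b \<times> 'c \<Rightarrow> real" where
  "energy = (\<lambda>(b, c). (norm (S b c))\<^sup>2)"

text \<open>The part of degree two in \<open>(u, v)\<close> of \<open>\<parallel>S (b + u) (c + v)\<parallel>\<^sup>2 - (1 + \<parallel>u\<parallel>\<^sup>2) (1 + \<parallel>v\<parallel>\<^sup>2) \<parallel>S b c\<parallel>\<^sup>2\<close>. It is half of the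
  quadratic form of the Hessian, see \<open>hessian_quad_energy\<close>.\<close>

definition second_variation :: "'b \<times> 'c \<Rightarrow> 'b \<times> 'c \<Rightarrow> real" where
  "second_variation = (\<lambda>(b, c) (u, v). (norm (S u c + S b v))\<^sup>2 + 2 * (S b c \<bullet> S u v)
     - (norm (S b c))\<^sup>2 * ((norm u)\<^sup>2 + (norm v)\<^sup>2))"

lemmas S_simps = bounded_bilinear.add_left[OF bil] bounded_bilinear.add_right[OF bil]
  bounded_bilinear.diff_left[OF bil] bounded_bilinear.diff_right[OF bil]
  bounded_bilinear.scaleR_left[OF bil] bounded_bilinear.scaleR_right[OF bil]
  bounded_bilinear.minus_left[OF bil] bounded_bilinear.minus_right[OF bil]
  bounded_bilinear.zero_left[OF bil] bounded_bilinear.zero_right[OF bil]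

lemma norm_S_sgn: "norm (S (sgn x) (sgn y)) = norm (S x y) / (norm x * norm y)"
  by (simp add: sgn_div_norm S_simps divide_inverse)

lemma continuous_on_S [continuous_intros]:
  "continuous_on A f \<Longrightarrow> continuous_on A g \<Longrightarrow> continuous_on A (\<lambda>x. S (f x) (g x))"
  by (rule bounded_bilinear.continuous_on[OF bil])

lemma continuous_on_energy: "continuous_on A energy"
  unfolding energy_def case_prod_beta by (intro continuous_intros)

lemma hessian_quad_energy: "hessian_quad energy p \<xi> = 2 * second_variation p \<xi>"
proof (cases p; cases \<xi>)
  fix b c u v assume p: "p = (b, c)" and xi: "\<xi> = (u, v)"
  define \<beta> where "\<beta> = great_circle b u"
  define \<gamma> where "\<gamma> = great_circle c v"
  define \<beta>1 where "\<beta>1 t = cos (t * norm u) *\<^sub>R u - (norm u * sin (t * norm u)) *\<^sub>R b" for t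
  define \<gamma>1 where "\<gamma>1 t = cos (t * norm v) *\<^sub>R v - (norm v * sin (t * norm v)) *\<^sub>R c" for t
  note \<beta> = great_circle_derivs[of b u, folded \<beta>_def \<beta>1_def]
  note \<gamma> = great_circle_derivs[of c v, folded \<gamma>_def \<gamma>1_def]
  have \<beta>2: "(\<beta>1 has_vector_derivative (- (norm u)\<^sup>2) *\<^sub>R b) (at 0)"
    unfolding \<beta>1_def[abs_def] by (rule great_circle_derivs(2))
  have \<gamma>2: "(\<gamma>1 has_vector_derivative (- (norm v)\<^sup>2) *\<^sub>R c) (at 0)"
    unfolding \<gamma>1_def[abs_def] by (rule great_circle_derivs(2))
  have at0: "\<beta>1 0 = u" "\<gamma>1 0 = v" by (simp_all add: \<beta>1_def \<gamma>1_def)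
  note der = bounded_bilinear.has_vector_derivative[OF bil]
    bounded_bilinear.has_vector_derivative[OF bounded_bilinear_inner]
  define w1 where "w1 t = S (\<beta> t) (\<gamma>1 t) + S (\<beta>1 t) (\<gamma> t)" for t
  have w: "((\<lambda>t. S (\<beta> t) (\<gamma> t)) has_vector_derivative w1 t) (at t)" for t
    unfolding w1_def by (rule der(1)[OF \<beta>(1) \<gamma>(1)])
  have h: "((\<lambda>t. energy (\<beta> t, \<gamma> t)) has_vector_derivative 2 * (S (\<beta> t) (\<gamma> t) \<bullet> w1 t)) (at t)" for t
    using der(2)[OF w w, of t]
    by (simp add: energy_def power2_norm_eq_inner inner_commute[of "w1 t"])
  have d1: "deriv (\<lambda>t. energy (\<beta> t, \<gamma> t)) = (\<lambda>t. 2 * (S (\<beta> t) (\<gamma> t) \<bullet> w1 t))"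
    by (rule ext, rule DERIV_imp_deriv) (use h in \<open>simp add: has_real_derivative_iff_has_vector_derivative\<close>)
  have "(w1 has_vector_derivative (S (\<beta> 0) ((- (norm v)\<^sup>2) *\<^sub>R c) + S (\<beta>1 0) (\<gamma>1 0)) +
       (S (\<beta>1 0) (\<gamma>1 0) + S ((- (norm u)\<^sup>2) *\<^sub>R b) (\<gamma> 0))) (at 0)"
    unfolding w1_def[abs_def]
    by (intro has_vector_derivative_add der(1) \<beta>(1) \<gamma>(1) \<beta>2 \<gamma>2)
  from der(2)[OF w this]
  have "((\<lambda>t. S (\<beta> t) (\<gamma> t) \<bullet> w1 t) has_real_derivative second_variation (b, c) (u, v)) (at 0)"
    unfolding has_real_derivative_iff_has_vector_derivative
    by (rule back_subst[where P = "\<lambda>x. (_ has_vector_derivative x) _"])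
       (simp add: \<beta>(3) \<gamma>(3) at0 w1_def second_variation_def S_simps power2_norm_eq_inner
         inner_simps inner_commute algebra_simps)
  then have "deriv (\<lambda>t. 2 * (S (\<beta> t) (\<gamma> t) \<bullet> w1 t)) 0 = 2 * second_variation (b, c) (u, v)"
    by (intro DERIV_imp_deriv DERIV_cmult)
  then show ?thesis
    by (simp add: hessian_quad_def p xi d1 numeral_2_eq_2 flip: \<beta>_def \<gamma>_def)
qed

text \<open>The polar form of the quadratic form \<open>second_variation\<close> is \<open>hessian energy / 2\<close>.\<close>

lemma second_variation_add:
  "second_variation p (\<xi> + t *\<^sub>R \<eta>) =
     second_variation p \<xi> + t * hessian energy p \<xi> \<eta> + t\<^sup>2 * second_variation p \<eta>"
proof (cases p; cases \<xi>; cases \<eta>)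
  fix b c u v u' v' assume "p = (b, c)" "\<xi> = (u, v)" "\<eta> = (u', v')"
  then show ?thesis
    unfolding hessian_def hessian_quad_energy
    apply (simp add: second_variation_def S_simps power2_norm_eq_inner)
    by (simp add: inner_simps inner_commute
        power2_eq_square algebra_simps add_divide_distrib diff_divide_distrib)
qed

lemma second_variation_scale: "second_variation p (t *\<^sub>R \<xi>) = t\<^sup>2 * second_variation p \<xi>"
proof (cases p; cases \<xi>)
  fix b c u v assume "p = (b, c)" "\<xi> = (u, v)"
  then show ?thesis
    apply (simp add: second_variation_def S_simps power2_norm_eq_inner)
    by (simp add: inner_simps inner_commute power2_eq_square algebra_simps)
qed

text \<open>A semidefinite form that is nonsingular is definite; the sign \<open>\<sigma>\<close> treats maxima and minima
  together.\<close>

lemma nondegenerate_definite: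
  assumes sd: "\<And>\<eta>. \<eta> \<in> sphere_prod_tangent p \<Longrightarrow> \<sigma> * second_variation p \<eta> \<le> 0"
    and nd: "hessian_nonsingular energy p" and s: "\<sigma> \<noteq> 0"
    and \<xi>: "\<xi> \<in> sphere_prod_tangent p" "\<xi> \<noteq> 0"
  shows "\<sigma> * second_variation p \<xi> < 0"
proof (rule ccontr)
  assume "\<not> ?thesis"
  with sd[OF \<xi>(1)] have z: "\<sigma> * second_variation p \<xi> = 0" by simp
  then have z': "second_variation p \<xi> = 0" using s by simp
  have "hessian energy p \<xi> \<eta> = 0" if \<eta>: "\<eta> \<in> sphere_prod_tangent p" for \<eta>
  proof -
    have "(\<sigma> * hessian energy p \<xi> \<eta>) * t + (\<sigma> * second_variation p \<eta>) * t^2 + 0 * t^3 + 0 * t^4 \<le> 0" for t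
    proof -
      have "\<xi> + t *\<^sub>R \<eta> \<in> sphere_prod_tangent p"
        using \<eta> \<xi>(1) by (auto simp: sphere_prod_tangent_def inner_simps)
      from sd[OF this] show ?thesis
        unfolding second_variation_add z' by (simp add: algebra_simps)
    qed
    from quartic_nonpos_coeffs(1)[OF this] show ?thesis using s by simp
  qed
  with nd \<xi> show False by (auto simp: hessian_nonsingular_def)
qed

text \<open>The terms of degree three and four in the expansion of \<open>energy_central_chart\<close>.\<close>

definition chart_remainder :: "'b \<times> 'c \<Rightarrow> 'b \<times> 'c \<Rightarrow> real" where
  "chart_remainder = (\<lambda>(b, c) (u, v). 2 * ((S u c + S b v) \<bullet> S u v) + (norm (S u v))\<^sup>2
     - (norm (S b c))\<^sup>2 * (norm u)\<^sup>2 * (norm v)\<^sup>2)"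

text \<open>Central projection of the tangent planes, \<open>(u, v) \<mapsto> (sgn (b + u), sgn (c + v))\<close>, gives a chart in
  which the difference of the energies is, up to a positive factor, a polynomial of degree four.\<close>

lemma energy_central_chart:
  assumes p: "(b, c) \<in> sphere_prod" and \<xi>: "(u, v) \<in> sphere_prod_tangent (b, c)"
  shows "(sgn (b + u), sgn (c + v)) \<in> sphere_prod" (is "?q \<in> _")
    and "(1 + (norm u)\<^sup>2) * (1 + (norm v)\<^sup>2) * (energy (sgn (b + u), sgn (c + v)) - energy (b, c)) =
      2 * (S b c \<bullet> (S u c + S b v)) + second_variation (b, c) (u, v) + chart_remainder (b, c) (u, v)"
proof -
  have n: "norm b = 1" "norm c = 1" using p by (auto simp: sphere_prod_def)
  have o: "b \<bullet> u = 0" "c \<bullet> v = 0" using \<xi> by (auto simp: sphere_prod_tangent_def inner_commute)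
  have nb: "(norm (b + u))\<^sup>2 = 1 + (norm u)\<^sup>2" and nc: "(norm (c + v))\<^sup>2 = 1 + (norm v)\<^sup>2"
    using n o by (auto simp: norm_add_Pythagorean orthogonal_def)
  have "b + u \<noteq> 0" "c + v \<noteq> 0"
    using nb nc by (metis add_nonneg_eq_0_iff norm_zero zero_eq_power2 zero_le_power2 zero_le_one zero_neq_one)+
  then show "?q \<in> sphere_prod" by (simp add: sphere_prod_def norm_sgn)
  have "energy ?q * ((norm (b + u))\<^sup>2 * (norm (c + v))\<^sup>2) = (norm (S (b + u) (c + v)))\<^sup>2"
    using \<open>b + u \<noteq> 0\<close> \<open>c + v \<noteq> 0\<close>
    by (simp add: energy_def norm_S_sgn power_divide power_mult_distrib)
  then have "energy ?q * ((1 + (norm u)\<^sup>2) * (1 + (norm v)\<^sup>2)) = (norm (S (b + u) (c + v)))\<^sup>2"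
    by (simp only: nb nc)
  moreover have "(norm (S (b + u) (c + v)))\<^sup>2 - (1 + (norm u)\<^sup>2) * (1 + (norm v)\<^sup>2) * energy (b, c) =
     2 * (S b c \<bullet> (S u c + S b v)) + second_variation (b, c) (u, v) + chart_remainder (b, c) (u, v)"
    apply (simp add: energy_def second_variation_def chart_remainder_def S_simps power2_norm_eq_inner)
    by (simp add: inner_simps inner_commute algebra_simps)
  ultimately show "(1 + (norm u)\<^sup>2) * (1 + (norm v)\<^sup>2) * (energy ?q - energy (b, c)) =
      2 * (S b c \<bullet> (S u c + S b v)) + second_variation (b, c) (u, v) + chart_remainder (b, c) (u, v)"
    by (simp add: algebra_simps)
qed

lemma extremum_conditions:
  assumes p: "(b, c) \<in> sphere_prod" and \<xi>: "(u, v) \<in> sphere_prod_tangent (b, c)"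
    and ext: "\<And>q. q \<in> sphere_prod \<Longrightarrow> \<sigma> * energy q \<le> \<sigma> * energy (b, c)"
  shows "\<sigma> * (S b c \<bullet> (S u c + S b v)) = 0" and "\<sigma> * second_variation (b, c) (u, v) \<le> 0"
proof -
  define r s where "r = 2 * ((S u c + S b v) \<bullet> S u v)"
    and "s = (norm (S u v))\<^sup>2 - (norm (S b c))\<^sup>2 * (norm u)\<^sup>2 * (norm v)\<^sup>2"
  have "(\<sigma> * (2 * (S b c \<bullet> (S u c + S b v)))) * t + (\<sigma> * second_variation (b, c) (u, v)) * t^2
      + (\<sigma> * r) * t^3 + (\<sigma> * s) * t^4 \<le> 0" (is "?l t \<le> 0") for t
  proof -
    have t: "(t *\<^sub>R u, t *\<^sub>R v) \<in> sphere_prod_tangent (b, c)"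
      using \<xi> by (auto simp: sphere_prod_tangent_def)
    note chart = energy_central_chart[OF p t]
    have "?l t = \<sigma> * (2 * (S b c \<bullet> (S (t *\<^sub>R u) c + S b (t *\<^sub>R v)))
       + second_variation (b, c) (t *\<^sub>R u, t *\<^sub>R v) + chart_remainder (b, c) (t *\<^sub>R u, t *\<^sub>R v))"
      apply (simp add: second_variation_def chart_remainder_def r_def s_def S_simps power2_norm_eq_inner)
      by (simp add: inner_simps inner_commute power2_eq_square power3_eq_cube power4_eq_xxxx algebra_simps)
    also have "\<dots> = (1 + (norm (t *\<^sub>R u))\<^sup>2) * (1 + (norm (t *\<^sub>R v))\<^sup>2) *
        (\<sigma> * energy (sgn (b + t *\<^sub>R u), sgn (c + t *\<^sub>R v)) - \<sigma> * energy (b, c))"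
      unfolding chart(2)[symmetric] by (simp add: algebra_simps)
    also have "\<dots> \<le> 0"
      using ext[OF chart(1)] by (intro mult_nonneg_nonpos) auto
    finally show ?thesis .
  qed
  note * = quartic_nonpos_coeffs[OF this]
  show "\<sigma> * (S b c \<bullet> (S u c + S b v)) = 0" using *(1) by simp
  show "\<sigma> * second_variation (b, c) (u, v) \<le> 0" using *(2) .
qed

lemma chart_remainder_bound:
  assumes "norm b = 1" "norm c = 1"
  shows "\<exists>R\<ge>0. \<forall>u v. norm (u, v) \<le> 1 \<longrightarrow> \<bar>chart_remainder (b, c) (u, v)\<bar> \<le> R * norm (u, v) ^ 3"
proof -
  obtain N where N: "N > 0" "\<And>x y. norm (S x y) \<le> norm x * norm y * N"
    using bounded_bilinear.pos_bounded[OF bil] by blast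
  define m where "m = (norm (S b c))\<^sup>2"
  have "\<bar>chart_remainder (b, c) (u, v)\<bar> \<le> (5 * N\<^sup>2 + m) * norm (u, v) ^ 3" if le: "norm (u, v) \<le> 1" for u v
  proof -
    define r where "r = norm (u, v)"
    have r: "0 \<le> r" "r \<le> 1" "norm u \<le> r" "norm v \<le> r"
      using le norm_fst_le[of u v] norm_snd_le[of v u] by (auto simp: r_def)
    have S1: "norm (S u c + S b v) \<le> 2 * (r * N)"
    proof -
      have "norm u * N \<le> r * N" "norm v * N \<le> r * N" using r N(1) by (auto intro: mult_right_mono)
      then have "norm (S u c) \<le> r * N" "norm (S b v) \<le> r * N"
        using N(2)[of u c] N(2)[of b v] assms by auto
      then show ?thesis using norm_triangle_ineq[of "S u c" "S b v"] by linarith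
    qed
    have uv: "norm u * norm v \<le> r * r" using r by (intro mult_mono) auto
    then have S2: "norm (S u v) \<le> r * r * N"
      using N(2)[of u v] N(1) by (smt (verit) mult_right_mono)
    have "\<bar>2 * ((S u c + S b v) \<bullet> S u v)\<bar> \<le> 2 * (norm (S u c + S b v) * norm (S u v))"
      using Cauchy_Schwarz_ineq2[of "S u c + S b v" "S u v"] by (simp add: abs_mult)
    also have "\<dots> \<le> 2 * ((2 * (r * N)) * (r * r * N))"
      using S1 S2 N(1) r by (intro mult_left_mono mult_mono) auto
    finally have 1: "\<bar>2 * ((S u c + S b v) \<bullet> S u v)\<bar> \<le> 4 * N\<^sup>2 * r ^ 3"
      by (simp add: power2_eq_square power3_eq_cube algebra_simps)
    have r43: "r ^ 4 \<le> r ^ 3" using r by (intro power_decreasing) auto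
    have "(norm (S u v))\<^sup>2 \<le> (r * r * N)\<^sup>2" using S2 by (intro power_mono) auto
    also have "\<dots> = N\<^sup>2 * r ^ 4" by (simp add: power2_eq_square power4_eq_xxxx algebra_simps)
    also have "\<dots> \<le> N\<^sup>2 * r ^ 3" using r43 by (intro mult_left_mono) auto
    finally have 2: "(norm (S u v))\<^sup>2 \<le> N\<^sup>2 * r ^ 3" .
    have "m * (norm u)\<^sup>2 * (norm v)\<^sup>2 = m * (norm u * norm v)\<^sup>2" by (simp add: power_mult_distrib)
    also have "\<dots> \<le> m * (r * r)\<^sup>2" using uv by (intro mult_left_mono power_mono) (auto simp: m_def)
    also have "\<dots> = m * r ^ 4" by (simp add: power2_eq_square power4_eq_xxxx)
    also have "\<dots> \<le> m * r ^ 3" using r43 by (intro mult_left_mono) (auto simp: m_def)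
    finally have 3: "m * (norm u)\<^sup>2 * (norm v)\<^sup>2 \<le> m * r ^ 3" .
    have 4: "0 \<le> m * (norm u)\<^sup>2 * (norm v)\<^sup>2" by (simp add: m_def)
    have "\<bar>2 * ((S u c + S b v) \<bullet> S u v) + (norm (S u v))\<^sup>2 - m * (norm u)\<^sup>2 * (norm v)\<^sup>2\<bar>
        \<le> 4 * N\<^sup>2 * r ^ 3 + N\<^sup>2 * r ^ 3 + m * r ^ 3"
      using 1 2 3 4 zero_le_power2[of "norm (S u v)"] by linarith
    then show ?thesis
      unfolding chart_remainder_def prod.case m_def[symmetric] r_def[symmetric] by (simp add: algebra_simps)
  qed
  then show ?thesis by (intro exI[of _ "5 * N\<^sup>2 + m"]) (auto simp: m_def)
qed

lemma nondegenerate_extremum_isolated: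
  assumes ext: "extremum_on energy sphere_prod p" and nd: "hessian_nonsingular energy p"
  shows "\<exists>e>0. \<forall>q\<in>sphere_prod. dist q p < e \<longrightarrow> energy q = energy p \<longrightarrow> q = p"
proof -
  obtain b c where p: "p = (b, c)" by force
  have pS: "(b, c) \<in> sphere_prod" using ext p by (auto simp: extremum_on_def)
  then have n: "norm b = 1" "norm c = 1" by (auto simp: sphere_prod_def)
  obtain \<sigma> :: real where \<sigma>: "\<sigma> \<noteq> 0" "\<bar>\<sigma>\<bar> = 1" "\<And>q. q \<in> sphere_prod \<Longrightarrow> \<sigma> * energy q \<le> \<sigma> * energy (b, c)"
  proof (cases "\<forall>q\<in>sphere_prod. energy q \<le> energy p")
    case True then show ?thesis using that[of 1] p by auto
  next
    case False then show ?thesis using that[of "-1"] p ext by (auto simp: extremum_on_def)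
  qed
  note cond = extremum_conditions[OF pS _ \<sigma>(3)]
  have neg: "\<sigma> * second_variation p \<xi> < 0" if "\<xi> \<in> sphere_prod_tangent p" "\<xi> \<noteq> 0" for \<xi>
    using nondegenerate_definite[OF _ nd \<sigma>(1) that] cond(2) p by (metis surj_pair)
  define K where "K = sphere_prod_tangent p \<inter> sphere 0 1"
  have "closed (sphere_prod_tangent p)"
  proof -
    have "sphere_prod_tangent p = {\<xi>. fst \<xi> \<bullet> b = 0} \<inter> {\<xi>. snd \<xi> \<bullet> c = 0}"
      by (auto simp: sphere_prod_tangent_def p)
    then show ?thesis by (auto intro!: closed_Int closed_Collect_eq continuous_intros)
  qed
  then have K: "compact K" unfolding K_def by (metis closed_Int_compact compact_sphere)
  have contK: "continuous_on K (\<lambda>\<xi>. \<sigma> * second_variation p \<xi>)"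
    unfolding second_variation_def p case_prod_beta by (intro continuous_intros)
  obtain \<kappa> where \<kappa>: "\<kappa> > 0" "\<And>\<xi>. \<xi> \<in> K \<Longrightarrow> \<sigma> * second_variation p \<xi> \<le> - \<kappa>"
  proof (cases "K = {}")
    case True then show ?thesis using that[of 1] by auto
  next
    case False
    obtain \<xi>0 where "\<xi>0 \<in> K" "\<And>\<xi>. \<xi> \<in> K \<Longrightarrow> \<sigma> * second_variation p \<xi> \<le> \<sigma> * second_variation p \<xi>0"
      using continuous_attains_sup[OF K False contK] by auto
    moreover from this have "\<xi>0 \<noteq> 0" by (auto simp: K_def)
    ultimately show ?thesis using neg[of \<xi>0] that[of "- (\<sigma> * second_variation p \<xi>0)"] by (auto simp: K_def)
  qed
  have quad: "\<sigma> * second_variation p \<xi> \<le> - \<kappa> * (norm \<xi>)\<^sup>2" if \<xi>: "\<xi> \<in> sphere_prod_tangent p" for \<xi>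
  proof (cases "\<xi> = 0")
    case True then show ?thesis by (simp add: second_variation_def p S_simps zero_prod_def)
  next
    case False
    define \<eta> where "\<eta> = \<xi> /\<^sub>R norm \<xi>"
    have "\<eta> \<in> K" using \<xi> False by (auto simp: K_def \<eta>_def sphere_prod_tangent_def)
    then have "(norm \<xi>)\<^sup>2 * (\<sigma> * second_variation p \<eta>) \<le> (norm \<xi>)\<^sup>2 * (- \<kappa>)"
      by (intro mult_left_mono \<kappa>(2)) auto
    moreover have "second_variation p \<xi> = (norm \<xi>)\<^sup>2 * second_variation p \<eta>"
      using second_variation_scale[of p "norm \<xi>" \<eta>] False by (simp add: \<eta>_def)
    ultimately show ?thesis by (simp add: algebra_simps)
  qed
  obtain R where R: "R \<ge> 0" "\<And>u v. norm (u, v) \<le> 1 \<Longrightarrow> \<bar>chart_remainder (b, c) (u, v)\<bar> \<le> R * norm (u, v) ^ 3"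
    using chart_remainder_bound[OF n] by blast
  \<comment> \<open>Within this radius, the terms of degree three and four are dominated by the definite
    quadratic term.\<close>
  define \<rho> where "\<rho> = min 1 (\<kappa> / (R + 1))"
  have \<rho>: "\<rho> > 0" using \<kappa>(1) R(1) by (simp add: \<rho>_def)
  have chart_ne: "energy (sgn (b + u), sgn (c + v)) \<noteq> energy (b, c)"
    if \<xi>: "(u, v) \<in> sphere_prod_tangent (b, c)" "norm (u, v) < \<rho>" "(u, v) \<noteq> 0" for u v
  proof
    assume "energy (sgn (b + u), sgn (c + v)) = energy (b, c)"
    with energy_central_chart(2)[OF pS \<xi>(1)]
    have "\<sigma> * (2 * (S b c \<bullet> (S u c + S b v)) + second_variation (b, c) (u, v) + chart_remainder (b, c) (u, v)) = 0"
      by simp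
    then have "\<sigma> * second_variation (b, c) (u, v) + \<sigma> * chart_remainder (b, c) (u, v) = 0"
      using cond(1)[OF \<xi>(1)] by (simp add: algebra_simps)
    moreover define x where "x = norm (u, v)"
    have "\<sigma> * second_variation (b, c) (u, v) \<le> - \<kappa> * x\<^sup>2"
      using quad[of "(u, v)"] \<xi>(1) p by (simp add: x_def)
    moreover have "\<bar>\<sigma> * chart_remainder (b, c) (u, v)\<bar> \<le> R * x ^ 3"
      using R(2)[of u v] \<xi>(2) \<sigma>(2) by (simp add: abs_mult x_def \<rho>_def)
    ultimately have "\<kappa> * x\<^sup>2 \<le> R * x ^ 3" by linarith
    then have "x\<^sup>2 * \<kappa> \<le> x\<^sup>2 * (R * x)" by (simp add: power2_eq_square power3_eq_cube algebra_simps)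
    moreover have "x > 0" using \<xi>(3) by (simp add: x_def)
    ultimately have "\<kappa> \<le> R * x" by simp
    also have "\<dots> \<le> (R + 1) * x" using \<open>x > 0\<close> by simp
    also have "\<dots> < (R + 1) * (\<kappa> / (R + 1))" using \<xi>(2) R(1) by (intro mult_strict_left_mono) (auto simp: x_def \<rho>_def)
    finally show False using R(1) by simp
  qed
  \<comment> \<open>The inverse of the central chart, defined near \<open>p\<close>.\<close>
  define U where "U q = fst q /\<^sub>R (fst q \<bullet> b) - b" for q :: "'b \<times> 'c"
  define V where "V q = snd q /\<^sub>R (snd q \<bullet> c) - c" for q :: "'b \<times> 'c"
  have bb: "b \<bullet> b = 1" "c \<bullet> c = 1" using n by (auto simp: norm_eq_1)
  have "((\<lambda>q. fst q \<bullet> b) \<longlongrightarrow> 1) (nhds p)" "((\<lambda>q. snd q \<bullet> c) \<longlongrightarrow> 1) (nhds p)"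
    using tendsto_inner[OF tendsto_fst[OF tendsto_ident_at[of p UNIV]] tendsto_const, of b]
      tendsto_inner[OF tendsto_snd[OF tendsto_ident_at[of p UNIV]] tendsto_const, of c] bb
    unfolding tendsto_nhds_iff by (simp_all add: p)
  then have ev1: "\<forall>\<^sub>F q in nhds p. 0 < fst q \<bullet> b" "\<forall>\<^sub>F q in nhds p. 0 < snd q \<bullet> c"
    by (auto intro: order_tendstoD)
  have "isCont (\<lambda>q. (U q, V q)) p"
    unfolding U_def V_def using bb by (intro continuous_intros) (auto simp: p)
  then have "((\<lambda>q. (U q, V q)) \<longlongrightarrow> (U p, V p)) (nhds p)"
    unfolding isCont_def tendsto_nhds_iff by simp
  moreover have "(U p, V p) = 0" using bb by (simp add: U_def V_def p zero_prod_def)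
  ultimately have "((\<lambda>q. norm (U q, V q)) \<longlongrightarrow> 0) (nhds p)"
    using tendsto_norm_zero by metis
  then have "\<forall>\<^sub>F q in nhds p. norm (U q, V q) < \<rho>" using \<rho> by (rule order_tendstoD)
  with ev1 have "\<forall>\<^sub>F q in nhds p. 0 < fst q \<bullet> b \<and> 0 < snd q \<bullet> c \<and> norm (U q, V q) < \<rho>"
    by eventually_elim auto
  then obtain e where e: "e > 0"
    "\<And>q. dist q p < e \<Longrightarrow> 0 < fst q \<bullet> b \<and> 0 < snd q \<bullet> c \<and> norm (U q, V q) < \<rho>"
    unfolding eventually_nhds_metric by blast
  have "q = p" if q: "q \<in> sphere_prod" "dist q p < e" "energy q = energy p" for q
  proof -
    from e(2)[OF q(2)] have pos: "0 < fst q \<bullet> b" "0 < snd q \<bullet> c" and sm: "norm (U q, V q) < \<rho>" by auto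
    have nq: "norm (fst q) = 1" "norm (snd q) = 1" using q(1) by (auto simp: sphere_prod_def)
    have tan: "(U q, V q) \<in> sphere_prod_tangent (b, c)"
      using pos bb by (auto simp: sphere_prod_tangent_def U_def V_def inner_simps)
    have "sgn (b + U q) = fst q" "sgn (c + V q) = snd q"
      using pos nq by (auto simp: U_def V_def sgn_div_norm)
    then have qe: "q = (sgn (b + U q), sgn (c + V q))" by simp
    then have "(U q, V q) = 0" using chart_ne[OF tan sm] q(3) p by metis
    then show "q = p" using qe n p by (simp add: zero_prod_def sgn_div_norm)
  qed
  with e(1) show ?thesis by blast
qed

end

section \<open>Continua through two maxima that avoid finitely many points\<close>

text \<open>Infinitely many arcs from \<open>p\<close> to \<open>q\<close> that are pairwise disjoint except for their ends cannot all
  meet a finite set.\<close>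

lemma continuum_avoiding_finite:
  fixes \<gamma> :: "real \<Rightarrow> real \<Rightarrow> 'a::topological_space"
  assumes Z: "finite Z" and pq: "p \<notin> Z" "q \<notin> Z"
    and cont: "\<And>s. continuous_on {0..pi} (\<gamma> s)"
    and ends: "\<And>s. \<gamma> s 0 = p" "\<And>s. \<gamma> s pi = q"
    and M: "\<And>s t. \<gamma> s t \<in> M"
    and inj: "\<And>s s' t t'. \<lbrakk>s \<in> {0..1}; s' \<in> {0..1}; t \<in> {0<..<pi}; t' \<in> {0<..<pi}; \<gamma> s t = \<gamma> s' t'\<rbrakk> \<Longrightarrow> s = s'"
  shows "\<exists>C\<subseteq>M. compact C \<and> connected C \<and> p \<in> C \<and> q \<in> C \<and> C \<inter> Z = {}"
proof -
  have "\<exists>s\<in>{0..1}. \<gamma> s ` {0..pi} \<inter> Z = {}"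
  proof (rule ccontr)
    assume "\<not> ?thesis"
    then have "\<forall>s\<in>{0..1}. \<exists>t\<in>{0..pi}. \<gamma> s t \<in> Z" by auto
    then obtain h where h: "\<And>s. s \<in> {0..1} \<Longrightarrow> h s \<in> {0..pi} \<and> \<gamma> s (h s) \<in> Z" by metis
    have h': "h s \<in> {0<..<pi}" if "s \<in> {0..1}" for s
      using h[OF that] ends[of s] pq by (metis atLeastAtMost_iff greaterThanLessThan_iff order_le_less)
    have "inj_on (\<lambda>s. \<gamma> s (h s)) {0..1}"
      by (rule inj_onI) (use inj h' in blast)
    moreover have "(\<lambda>s. \<gamma> s (h s)) ` {0..1} \<subseteq> Z" using h by blast
    ultimately have "finite {0..1::real}" using Z by (meson finite_imageD finite_subset)
    then show False using infinite_Icc[of "0::real" 1] by simp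
  qed
  then obtain s where s: "\<gamma> s ` {0..pi} \<inter> Z = {}" by blast
  have "compact (\<gamma> s ` {0..pi})" "connected (\<gamma> s ` {0..pi})"
    by (intro compact_continuous_image connected_continuous_image cont; simp)+
  moreover have "p \<in> \<gamma> s ` {0..pi}" "q \<in> \<gamma> s ` {0..pi}"
    by (rule image_eqI[of _ _ 0]; simp add: ends) (rule image_eqI[of _ _ pi]; simp add: ends)
  ultimately show ?thesis using s M by (intro exI[of _ "\<gamma> s ` {0..pi}"]) auto
qed

lemma orthogonal_unit_vector_exists:
  fixes A :: "'a::euclidean_space set"
  assumes "finite A" "card A < DIM('a)"
  shows "\<exists>u. norm u = 1 \<and> (\<forall>a\<in>A. u \<bullet> a = 0)"
proof -
  have "dim A < DIM('a)" using dim_le_card[OF span_superset assms(1)] assms(2) by linarith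
  then obtain x where x: "x \<noteq> 0" "\<And>y. y \<in> span A \<Longrightarrow> orthogonal x y"
    using orthogonal_to_subspace_exists[of A] by metis
  show ?thesis
  proof (intro exI[of _ "sgn x"] conjI ballI)
    show "norm (sgn x) = 1" using x by (simp add: norm_sgn)
    show "sgn x \<bullet> a = 0" if "a \<in> A" for a
      using x(2)[OF span_base[OF that]] by (simp add: orthogonal_def sgn_div_norm)
  qed
qed

lemma norm_cos_sin:
  assumes "norm x = 1" "norm y = 1" "x \<bullet> y = 0"
  shows "norm (cos t *\<^sub>R x + sin t *\<^sub>R y) = 1"
  using assms by (simp add: norm_eq_1 inner_simps inner_commute[of y x])

text \<open>Meridians from \<open>c\<close> to its antipode; they are disjoint inside because the sphere has dimension at least two.\<close>

lemma half_circle_family: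
  fixes c :: "'a::euclidean_space"
  assumes "DIM('a) \<ge> 3" and c: "norm c = 1"
  shows "\<exists>\<gamma> :: real \<Rightarrow> real \<Rightarrow> 'a. (\<forall>s t. norm (\<gamma> s t) = 1) \<and>
      (\<forall>s A. continuous_on A (\<gamma> s)) \<and>
      (\<forall>s. \<gamma> s 0 = c \<and> \<gamma> s pi = - c) \<and>
      (\<forall>s\<in>{0..1}. \<forall>s'\<in>{0..1}. \<forall>t\<in>{0<..<pi}. \<forall>t'\<in>{0<..<pi}. \<gamma> s t = \<gamma> s' t' \<longrightarrow> s = s')"
proof -
  obtain u where u: "norm u = 1" "u \<bullet> c = 0"
    using orthogonal_unit_vector_exists[of "{c}"] assms by auto
  have "card {c, u} \<le> 2" by (simp add: card_insert_if)
  then have "card {c, u} < DIM('a)" using assms(1) by linarith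
  from orthogonal_unit_vector_exists[OF _ this] obtain v where v: "norm v = 1" "v \<bullet> c = 0" "v \<bullet> u = 0"
    by auto
  have i: "c \<bullet> c = 1" "u \<bullet> u = 1" "v \<bullet> v = 1" "c \<bullet> u = 0" "c \<bullet> v = 0" "u \<bullet> v = 0"
    using c u v by (auto simp: norm_eq_1 inner_commute)
  define \<gamma> where "\<gamma> s t = cos t *\<^sub>R c + sin t *\<^sub>R (cos s *\<^sub>R u + sin s *\<^sub>R v)" for s t
  have gc: "\<gamma> s t \<bullet> c = cos t" and gu: "\<gamma> s t \<bullet> u = sin t * cos s" for s t
    using i u v by (auto simp: \<gamma>_def inner_simps)
  show ?thesis
  proof (intro exI[of _ \<gamma>] conjI allI ballI impI)
    show "norm (\<gamma> s t) = 1" for s t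
      unfolding \<gamma>_def using u v c i by (intro norm_cos_sin) (auto simp: inner_simps)
    show "continuous_on A (\<gamma> s)" for s A unfolding \<gamma>_def by (intro continuous_intros)
    show "\<gamma> s 0 = c" "\<gamma> s pi = - c" for s by (simp_all add: \<gamma>_def)
    fix s s' t t' assume *: "s \<in> {0..1}" "s' \<in> {0..1}" "t \<in> {0<..<pi}" "t' \<in> {0<..<pi}" "\<gamma> s t = \<gamma> s' t'"
    have "cos t = cos t'" using gc[of s t] gc[of s' t'] *(5) by simp
    then have tt: "t = t'" using cos_inj_pi[of t t'] *(3,4) by simp
    have "sin t * cos s = sin t * cos s'" using gu[of s t, symmetric] gu[of s' t'] *(5) tt by simp
    moreover have "sin t \<noteq> 0" using *(3) sin_gt_zero[of t] by auto
    ultimately have "cos s = cos s'" by simp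
    then show "s = s'" using cos_inj_pi[of s s'] *(1,2) pi_gt3 by simp
  qed
qed

lemma antipodal_continuum:
  fixes b :: "'b::euclidean_space" and c :: "'c::euclidean_space"
  assumes dim: "DIM('b) + DIM('c) \<ge> 4" and n: "norm b = 1" "norm c = 1"
    and Z: "finite Z" "(b, c) \<notin> Z" "(- b, c) \<notin> Z" "(b, - c) \<notin> Z"
  shows "\<exists>p'\<in>{(- b, c), (b, - c)}. \<exists>C\<subseteq>sphere_prod.
    compact C \<and> connected C \<and> (b, c) \<in> C \<and> p' \<in> C \<and> C \<inter> Z = {}"
proof -
  consider "DIM('b) \<ge> 3" | "DIM('c) \<ge> 3" | "DIM('b) \<ge> 2" "DIM('c) \<ge> 2" using dim by linarith
  then show ?thesis
  proof cases
    case 1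
    obtain \<gamma> :: "real \<Rightarrow> real \<Rightarrow> 'b" where \<gamma>:
      "\<forall>s t. norm (\<gamma> s t) = 1" "\<forall>s A. continuous_on A (\<gamma> s)"
      "\<forall>s. \<gamma> s 0 = b \<and> \<gamma> s pi = - b"
      "\<forall>s\<in>{0..1}. \<forall>s'\<in>{0..1}. \<forall>t\<in>{0<..<pi}. \<forall>t'\<in>{0<..<pi}. \<gamma> s t = \<gamma> s' t' \<longrightarrow> s = s'"
      using half_circle_family[OF 1 n(1)] by blast
    have "\<exists>C\<subseteq>sphere_prod. compact C \<and> connected C \<and> (b, c) \<in> C \<and> (- b, c) \<in> C \<and> C \<inter> Z = {}"
    proof (rule continuum_avoiding_finite[of Z _ _ "\<lambda>s t. (\<gamma> s t, c)"])
      show "continuous_on {0..pi} (\<lambda>t. (\<gamma> s t, c))" for s using \<gamma>(2) by (intro continuous_intros) simp_all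
      show "s = s'" if "s \<in> {0..1}" "s' \<in> {0..1}" "t \<in> {0<..<pi}" "t' \<in> {0<..<pi}"
        "(\<gamma> s t, c) = (\<gamma> s' t', c)" for s s' t t'
        using \<gamma>(4) that by blast
    qed (use \<gamma>(1,3) n Z in \<open>simp_all add: sphere_prod_def\<close>)
    then show ?thesis by blast
  next
    case 2
    obtain \<gamma> :: "real \<Rightarrow> real \<Rightarrow> 'c" where \<gamma>:
      "\<forall>s t. norm (\<gamma> s t) = 1" "\<forall>s A. continuous_on A (\<gamma> s)"
      "\<forall>s. \<gamma> s 0 = c \<and> \<gamma> s pi = - c"
      "\<forall>s\<in>{0..1}. \<forall>s'\<in>{0..1}. \<forall>t\<in>{0<..<pi}. \<forall>t'\<in>{0<..<pi}. \<gamma> s t = \<gamma> s' t' \<longrightarrow> s = s'"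
      using half_circle_family[OF 2 n(2)] by blast
    have "\<exists>C\<subseteq>sphere_prod. compact C \<and> connected C \<and> (b, c) \<in> C \<and> (b, - c) \<in> C \<and> C \<inter> Z = {}"
    proof (rule continuum_avoiding_finite[of Z _ _ "\<lambda>s t. (b, \<gamma> s t)"])
      show "continuous_on {0..pi} (\<lambda>t. (b, \<gamma> s t))" for s using \<gamma>(2) by (intro continuous_intros) simp_all
      show "s = s'" if "s \<in> {0..1}" "s' \<in> {0..1}" "t \<in> {0<..<pi}" "t' \<in> {0<..<pi}"
        "(b, \<gamma> s t) = (b, \<gamma> s' t')" for s s' t t'
        using \<gamma>(4) that by blast
    qed (use \<gamma>(1,3) n Z in \<open>simp_all add: sphere_prod_def\<close>)
    then show ?thesis by blast
  next
    case 3
    obtain u where u: "norm u = 1" "u \<bullet> b = 0"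
      using orthogonal_unit_vector_exists[of "{b}"] 3 by auto
    obtain v where v: "norm v = 1" "v \<bullet> c = 0"
      using orthogonal_unit_vector_exists[of "{c}"] 3 by auto
    have i: "b \<bullet> b = 1" "u \<bullet> u = 1" "c \<bullet> c = 1" "v \<bullet> v = 1" "b \<bullet> u = 0" "c \<bullet> v = 0"
      using n u v by (auto simp: norm_eq_1 inner_commute)
    \<comment> \<open>While \<open>c\<close> runs through a half circle to \<open>- c\<close>, the other component makes an excursion from
      \<open>b\<close> whose size depends on \<open>s\<close>.\<close>
    define \<gamma> where "\<gamma> s t = (cos (s * sin t) *\<^sub>R b + sin (s * sin t) *\<^sub>R u, cos t *\<^sub>R c + sin t *\<^sub>R v)" for s t
    have gc: "snd (\<gamma> s t) \<bullet> c = cos t" and gb: "fst (\<gamma> s t) \<bullet> b = cos (s * sin t)" for s t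
      using i u v by (auto simp: \<gamma>_def inner_simps)
    have "\<exists>C\<subseteq>sphere_prod. compact C \<and> connected C \<and> (b, c) \<in> C \<and> (b, - c) \<in> C \<and> C \<inter> Z = {}"
    proof (rule continuum_avoiding_finite[of Z _ _ \<gamma>])
      show "continuous_on {0..pi} (\<gamma> s)" for s unfolding \<gamma>_def by (intro continuous_intros)
      show "\<gamma> s t \<in> sphere_prod" for s t
        unfolding \<gamma>_def sphere_prod_def using n u v i by (auto intro!: norm_cos_sin)
      fix s s' t t' assume *: "s \<in> {0..1}" "s' \<in> {0..1}" "t \<in> {0<..<pi}" "t' \<in> {0<..<pi}" "\<gamma> s t = \<gamma> s' t'"
      have "cos t = cos t'" using gc[of s t] gc[of s' t'] *(5) by simp
      then have tt: "t = t'" using cos_inj_pi[of t t'] *(3,4) by simp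
      have st: "0 < sin t" "sin t \<le> 1" using *(3) sin_gt_zero[of t] by auto
      have "cos (s * sin t) = cos (s' * sin t)" using gb[of s t] gb[of s' t'] *(5) tt by simp
      moreover have "r * sin t \<le> pi" "0 \<le> r * sin t" if "r \<in> {0..1}" for r
        using st that mult_mono[of r 1 "sin t" 1] pi_gt3 by simp_all
      ultimately have "s * sin t = s' * sin t" using cos_inj_pi[of "s * sin t" "s' * sin t"] *(1,2) by simp
      then show "s = s'" using st by simp
    qed (use Z in \<open>simp_all add: \<gamma>_def\<close>)
    then show ?thesis by blast
  qed
qed

section \<open>A critical point at a positive level that is not a local maximum\<close>

context trilinear_contractions begin

text \<open>One sweep of the shifted power iteration, first in \<open>b\<close> and then in \<open>c\<close> with the new \<open>b'\<close>.\<close>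

definition ascent_map :: "'b \<times> 'c \<Rightarrow> 'b \<times> 'c" where
  "ascent_map = (\<lambda>(b, c). let b' = sgn (b + S2 (S b c) c) in (b', sgn (c + S3 (S b' c) b')))"

lemma linear_S: "linear (\<lambda>b. S b c)" "linear (S b)"
  using bounded_bilinear.bounded_linear_left[OF bil] bounded_bilinear.bounded_linear_right[OF bil]
  by (auto intro: bounded_linear.linear)

lemmas left_ascent = rayleigh_ascent[OF linear_S(1) adj2]
lemmas right_ascent = rayleigh_ascent[OF linear_S(2) adj3]

lemma ascent_map_in: "p \<in> sphere_prod \<Longrightarrow> ascent_map p \<in> sphere_prod"
  using left_ascent(1)[of "fst p" 1 "snd p"] right_ascent(1)[of "snd p" 1 "fst (ascent_map p)"]
  by (auto simp: sphere_prod_def ascent_map_def norm_sgn Let_def)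

lemma continuous_on_ascent_map: "continuous_on sphere_prod ascent_map"
proof -
  define B where "B p = sgn (fst p + S2 (S (fst p) (snd p)) (snd p))" for p :: "'b \<times> 'c"
  have ne: "fst p + S2 (S (fst p) (snd p)) (snd p) \<noteq> 0" "norm (B p) = 1"
    "snd p + S3 (S (B p) (snd p)) (B p) \<noteq> 0" if "p \<in> sphere_prod" for p
  proof -
    have n: "norm (fst p) = 1" "norm (snd p) = 1" using that by (auto simp: sphere_prod_def)
    show *: "fst p + S2 (S (fst p) (snd p)) (snd p) \<noteq> 0" using left_ascent(1)[OF n(1), of 1] by simp
    then show "norm (B p) = 1" by (simp add: B_def norm_sgn)
    show "snd p + S3 (S (B p) (snd p)) (B p) \<noteq> 0" using right_ascent(1)[OF n(2), of 1] by simp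
  qed
  note c2 = bounded_bilinear.continuous_on[OF bil2] and c3 = bounded_bilinear.continuous_on[OF bil3]
  have B: "continuous_on sphere_prod B"
    unfolding B_def by (intro continuous_on_sgn continuous_intros c2 ballI ne)
  have "continuous_on sphere_prod (\<lambda>p. (B p, sgn (snd p + S3 (S (B p) (snd p)) (B p))))"
    by (intro continuous_on_sgn continuous_intros c3 B ballI ne)
  moreover have "ascent_map = (\<lambda>p. (B p, sgn (snd p + S3 (S (B p) (snd p)) (B p))))"
    by (auto simp: ascent_map_def B_def Let_def fun_eq_iff)
  ultimately show ?thesis by simp
qed

lemma ascent_map_cases:
  assumes "(b, c) \<in> sphere_prod"
  shows "energy (b, c) < energy (ascent_map (b, c)) \<or>
    ascent_map (b, c) = (b, c) \<and> S2 (S b c) c = energy (b, c) *\<^sub>R b \<and> S3 (S b c) b = energy (b, c) *\<^sub>R c"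
proof -
  have n: "norm b = 1" "norm c = 1" using assms by (auto simp: sphere_prod_def)
  define b' where "b' = sgn (b + S2 (S b c) c)"
  define c' where "c' = sgn (c + S3 (S b' c) b')"
  have am: "ascent_map (b, c) = (b', c')" by (simp add: ascent_map_def Let_def b'_def c'_def)
  have 1: "energy (b, c) < energy (b', c) \<or> b' = b \<and> S2 (S b c) c = energy (b, c) *\<^sub>R b"
    using left_ascent(2)[OF n(1), of 1 c] left_ascent(3)[OF n(1), of 1 c]
    by (cases "S2 (S b c) c = energy (b, c) *\<^sub>R b") (simp_all add: energy_def b'_def)
  have 2: "energy (b', c) < energy (b', c') \<or> c' = c \<and> S3 (S b' c) b' = energy (b', c) *\<^sub>R c"
    using right_ascent(2)[OF n(2), of 1 b'] right_ascent(3)[OF n(2), of 1 b']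
    by (cases "S3 (S b' c) b' = energy (b', c) *\<^sub>R c") (simp_all add: energy_def c'_def)
  from 1 2 show ?thesis unfolding am by auto
qed

lemma local_max_fixed:
  assumes p: "p \<in> sphere_prod" and e: "e > 0"
    and max: "\<And>q. q \<in> sphere_prod \<Longrightarrow> dist q p < e \<Longrightarrow> energy q \<le> energy p"
  shows "ascent_map p = p"
proof -
  obtain b c where pe: "p = (b, c)" by force
  have n: "norm b = 1" "norm c = 1" using p by (auto simp: sphere_prod_def pe)
  have small: "\<exists>s>0. dist (sgn (x + s *\<^sub>R w)) x < e" if x: "norm x = 1" for x w :: "'z::euclidean_space"
  proof -
    have "((\<lambda>s. sgn (x + s *\<^sub>R w)) \<longlongrightarrow> sgn (x + 0 *\<^sub>R w)) (at_right 0)"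
      using x by (intro tendsto_intros) auto
    then have "\<forall>\<^sub>F s in at_right 0. dist (sgn (x + s *\<^sub>R w)) x < e"
      using e x by (auto simp: sgn_div_norm dest: tendstoD)
    then have "\<forall>\<^sub>F s in at_right 0. 0 < s \<and> dist (sgn (x + s *\<^sub>R w)) x < e"
      by (simp add: eventually_conj_iff eventually_at_right_less)
    then show ?thesis using eventually_happens'[OF trivial_limit_at_right_real] by blast
  qed
  have 1: "S2 (S b c) c = (norm (S b c))\<^sup>2 *\<^sub>R b"
  proof (rule ccontr)
    assume ne: "\<not> ?thesis"
    obtain s where s: "s > 0" "dist (sgn (b + s *\<^sub>R S2 (S b c) c)) b < e" using small[OF n(1)] by blast
    have "(sgn (b + s *\<^sub>R S2 (S b c) c), c) \<in> sphere_prod"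
      using left_ascent(1)[OF n(1) s(1)] n by (auto simp: sphere_prod_def norm_sgn)
    from max[OF this] show False
      using left_ascent(2)[OF n(1) s(1) ne] s(2) by (auto simp: pe energy_def dist_Pair_Pair dest: power2_less_imp_less)
  qed
  have 2: "S3 (S b c) b = (norm (S b c))\<^sup>2 *\<^sub>R c"
  proof (rule ccontr)
    assume ne: "\<not> ?thesis"
    obtain s where s: "s > 0" "dist (sgn (c + s *\<^sub>R S3 (S b c) b)) c < e" using small[OF n(2)] by blast
    have "(b, sgn (c + s *\<^sub>R S3 (S b c) b)) \<in> sphere_prod"
      using right_ascent(1)[OF n(2) s(1)] n by (auto simp: sphere_prod_def norm_sgn)
    from max[OF this] show False
      using right_ascent(2)[OF n(2) s(1) ne] s(2) by (auto simp: pe energy_def dist_Pair_Pair dest: power2_less_imp_less)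
  qed
  show ?thesis
    using left_ascent(3)[OF n(1) _ 1, of 1] right_ascent(3)[OF n(2) _ 2, of 1]
    by (simp add: pe ascent_map_def)
qed

text \<open>The two equations say that the point is critical with Lagrange multiplier \<open>energy (b, c)\<close> in
  both components.\<close>

theorem positive_saddle_exists:
  assumes dim: "DIM('b) + DIM('c) \<ge> 4"
    and nd: "\<And>p. extremum_on energy sphere_prod p \<Longrightarrow> hessian_nonsingular energy p"
  shows "\<exists>b c. (b, c) \<in> sphere_prod \<and> 0 < energy (b, c) \<and>
    S2 (S b c) c = energy (b, c) *\<^sub>R b \<and> S3 (S b c) b = energy (b, c) *\<^sub>R c \<and>
    (\<forall>e>0. \<exists>q\<in>sphere_prod. dist q (b, c) < e \<and> energy (b, c) < energy q)"
proof -
  let ?M = "sphere_prod :: ('b \<times> 'c) set"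
  have M: "compact ?M" unfolding sphere_prod_def by (intro compact_Times compact_sphere)
  obtain b0 :: 'b and c0 :: 'c where "b0 \<in> Basis" "c0 \<in> Basis" by (meson ex_in_conv nonempty_Basis)
  then have "(b0, c0) \<in> ?M" by (auto simp: sphere_prod_def)
  then obtain p where p: "p \<in> ?M" "\<And>q. q \<in> ?M \<Longrightarrow> energy q \<le> energy p"
    using continuous_attains_sup[OF M _ continuous_on_energy] by blast
  obtain b c where pe: "p = (b, c)" by force
  have n: "norm b = 1" "norm c = 1" using p(1) by (auto simp: sphere_prod_def pe)
  have nn: "0 \<le> energy q" for q by (auto simp: energy_def split: prod.split)
  have "extremum_on energy ?M p" using p by (auto simp: extremum_on_def)
  from nondegenerate_extremum_isolated[OF this nd[OF this]]
  obtain e where e: "e > 0" "\<And>q. q \<in> ?M \<Longrightarrow> dist q p < e \<Longrightarrow> energy q = energy p \<Longrightarrow> q = p" by blast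
  define Z where "Z = {q \<in> ?M. energy q = 0}"
  have Z: "finite Z"
  proof (rule ccontr)
    assume "infinite Z"
    moreover have "compact Z"
    proof -
      have "closedin (top_of_set ?M) (?M \<inter> energy -` {0})"
        by (rule continuous_closedin_preimage[OF continuous_on_energy]) simp
      moreover have "Z = ?M \<inter> energy -` {0}" by (auto simp: Z_def)
      ultimately show ?thesis using M closedin_compact by metis
    qed
    ultimately obtain z where z: "z \<in> Z" "z islimpt Z"
      by (metis compact_eq_Bolzano_Weierstrass subset_refl)
    have "extremum_on energy ?M z" using z(1) nn by (auto simp: extremum_on_def Z_def)
    from nondegenerate_extremum_isolated[OF this nd[OF this]]
    obtain d where "d > 0" "\<And>q. q \<in> ?M \<Longrightarrow> dist q z < d \<Longrightarrow> energy q = energy z \<Longrightarrow> q = z" by blast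
    moreover obtain q where "q \<in> Z" "q \<noteq> z" "dist q z < d"
      using z(2) \<open>d > 0\<close> unfolding islimpt_approachable by blast
    ultimately show False using z(1) by (simp add: Z_def)
  qed
  have "x \<noteq> - x" if "norm x = 1" for x :: "'z::euclidean_space"
  proof
    assume "x = - x"
    then have "x \<bullet> x = - (x \<bullet> x)" by (metis inner_minus_left)
    then show False using that by (simp add: norm_eq_1)
  qed
  from this[OF n(1)] this[OF n(2)] have neq: "p \<noteq> p'" and en: "energy p' = energy p" if "p' \<in> {(- b, c), (b, - c)}" for p'
    using that by (auto simp: pe energy_def S_simps)
  \<comment> \<open>If the maximum were zero, the whole product of spheres would consist of zeros, hence be
    finite, although it contains a connected set with more than one point.\<close>
  have pos: "0 < energy p"
  proof (rule ccontr)
    assume "\<not> ?thesis"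
    then have "energy q = 0" if "q \<in> ?M" for q using p(2)[OF that] nn[of q] by simp
    then have MZ: "?M \<subseteq> Z" by (auto simp: Z_def)
    obtain p' C where C: "p' \<in> {(- b, c), (b, - c)}" "C \<subseteq> ?M" "connected C" "p \<in> C" "p' \<in> C"
      using antipodal_continuum[OF dim n, of "{}"] pe by auto
    then have "finite C" using MZ Z by (meson finite_subset subset_trans)
    with C(3) have "C = {} \<or> (\<exists>x. C = {x})" using connected_finite_iff_sing by blast
    with C neq show False by blast
  qed
  have nZ: "(b, c) \<notin> Z" "(- b, c) \<notin> Z" "(b, - c) \<notin> Z"
    using pos en by (auto simp: Z_def pe)
  obtain p' C where p': "p' \<in> {(- b, c), (b, - c)}"
    and C: "compact C" "connected C" "C \<subseteq> ?M" "p \<in> C" "p' \<in> C" "C \<inter> Z = {}"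
    using antipodal_continuum[OF dim n Z nZ] pe by blast
  obtain m where m: "m \<in> C" "\<forall>q\<in>C. energy m \<le> energy q"
    using continuous_attains_inf[OF C(1) _ continuous_on_energy] C(4) by blast
  have "0 < energy m" using m(1) C(3,6) nn[of m] by (auto simp: Z_def order_less_le)
  have asc: "energy x < energy (ascent_map x)" if "x \<in> ?M" "ascent_map x \<noteq> x" for x
    using ascent_map_cases[of "fst x" "snd x"] that by auto
  have "\<exists>q\<in>?M. ascent_map q = q \<and> energy m \<le> energy q \<and>
      (\<forall>e>0. \<exists>y\<in>?M. dist y q < e \<and> energy q < energy y)"
    by (rule mountain_pass[OF M continuous_on_energy continuous_on_ascent_map _ asc local_max_fixed p(2)
          en[OF p'] neq[OF p'] e C(1-5)])
       (use ascent_map_in m(2) in blast)+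
  then obtain q where q: "q \<in> ?M" "ascent_map q = q" "energy m \<le> energy q"
    "\<forall>e>0. \<exists>y\<in>?M. dist y q < e \<and> energy q < energy y" by blast
  obtain x y where xy: "q = (x, y)" by force
  have "S2 (S x y) y = energy (x, y) *\<^sub>R x" "S3 (S x y) x = energy (x, y) *\<^sub>R y"
    using ascent_map_cases[of x y] q(1,2) by (simp_all add: xy)
  moreover have "0 < energy (x, y)" using q(3) \<open>0 < energy m\<close> by (simp add: xy)
  ultimately show ?thesis using q(1,4) unfolding xy by blast
qed

end

section \<open>Tensors and the alternating least squares iteration\<close>

lemma contract_adjoint:
  "contract1 T b c \<bullet> a = b \<bullet> contract2 T a c" "contract1 T b c \<bullet> a = c \<bullet> contract3 T a b"
proof -
  have "contract1 T b c \<bullet> a = (\<Sum>i\<in>UNIV. \<Sum>j\<in>UNIV. \<Sum>k\<in>UNIV. T $ i $ j $ k * a $ i * b $ j * c $ k)"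
    by (simp add: contract1_def inner_vec_def sum_distrib_left sum_distrib_right mult_ac)
  moreover have "b \<bullet> contract2 T a c = (\<Sum>j\<in>UNIV. \<Sum>i\<in>UNIV. \<Sum>k\<in>UNIV. T $ i $ j $ k * a $ i * b $ j * c $ k)"
    by (simp add: contract2_def inner_vec_def sum_distrib_left mult_ac)
  moreover have "c \<bullet> contract3 T a b = (\<Sum>k\<in>UNIV. \<Sum>i\<in>UNIV. \<Sum>j\<in>UNIV. T $ i $ j $ k * a $ i * b $ j * c $ k)"
    by (simp add: contract3_def inner_vec_def sum_distrib_left mult_ac)
  moreover have "(\<Sum>j\<in>UNIV. \<Sum>i\<in>UNIV. \<Sum>k\<in>UNIV. T $ i $ j $ k * a $ i * b $ j * c $ k)
     = (\<Sum>i\<in>UNIV. \<Sum>j\<in>UNIV. \<Sum>k\<in>UNIV. T $ i $ j $ k * a $ i * b $ j * c $ k)"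
    by (rule sum.swap)
  moreover have "(\<Sum>k\<in>UNIV. \<Sum>i\<in>UNIV. \<Sum>j\<in>UNIV. T $ i $ j $ k * a $ i * b $ j * c $ k)
     = (\<Sum>i\<in>UNIV. \<Sum>j\<in>UNIV. \<Sum>k\<in>UNIV. T $ i $ j $ k * a $ i * b $ j * c $ k)"
    by (subst sum.swap, rule sum.cong[OF refl], rule sum.swap)
  ultimately show "contract1 T b c \<bullet> a = b \<bullet> contract2 T a c" "contract1 T b c \<bullet> a = c \<bullet> contract3 T a b"
    by simp_all
qed

lemma bilinear_contract: "bilinear (contract1 T)" "bilinear (contract2 T)" "bilinear (contract3 T)"
  unfolding bilinear_def
  by (auto intro!: linearI simp: contract1_def contract2_def contract3_def vec_eq_iff
      algebra_simps sum.distrib sum_distrib_left)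

lemma bounded_bilinear_contract:
  "bounded_bilinear (contract1 T)" "bounded_bilinear (contract2 T)" "bounded_bilinear (contract3 T)"
  using bilinear_contract by (simp_all flip: bilinear_conv_bounded_bilinear)

lemma trilinear_contractions_contract:
  "trilinear_contractions (contract1 T) (contract2 T) (contract3 T)"
  by (intro trilinear_contractions.intro bounded_bilinear_contract contract_adjoint)

text \<open>The function \<open>energy\<close> of the locale for the contractions of the tensor \<open>T\<close>.\<close>

abbreviation contraction_energy where
  "contraction_energy T \<equiv> trilinear_contractions.energy (contract1 T)"

lemmas contraction_energy_def = trilinear_contractions.energy_def[OF trilinear_contractions_contract]

lemma quartic_form_energy: "quartic_form T = contraction_energy T"
proof (intro ext, clarify)
  fix b c
  have "(norm (contract1 T b c))\<^sup>2 = (\<Sum>i\<in>UNIV.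
      (\<Sum>\<alpha>\<in>UNIV. \<Sum>\<beta>\<in>UNIV. T $ i $ \<alpha> $ \<beta> * b $ \<alpha> * c $ \<beta>) * (\<Sum>\<gamma>\<in>UNIV. \<Sum>\<delta>\<in>UNIV. T $ i $ \<gamma> $ \<delta> * b $ \<gamma> * c $ \<delta>))"
    by (simp add: power2_norm_eq_inner inner_vec_def contract1_def)
  also have "\<dots> = (\<Sum>i\<in>UNIV. \<Sum>\<alpha>\<in>UNIV. \<Sum>\<beta>\<in>UNIV. \<Sum>\<gamma>\<in>UNIV. \<Sum>\<delta>\<in>UNIV.
      T $ i $ \<alpha> $ \<beta> * b $ \<alpha> * c $ \<beta> * (T $ i $ \<gamma> $ \<delta> * b $ \<gamma> * c $ \<delta>))"
    by (simp only: sum_distrib_left[symmetric] sum_distrib_right[symmetric])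
  also have "\<dots> = (\<Sum>\<alpha>\<in>UNIV. \<Sum>\<beta>\<in>UNIV. \<Sum>\<gamma>\<in>UNIV. \<Sum>\<delta>\<in>UNIV. \<Sum>i\<in>UNIV.
      T $ i $ \<alpha> $ \<beta> * b $ \<alpha> * c $ \<beta> * (T $ i $ \<gamma> $ \<delta> * b $ \<gamma> * c $ \<delta>))"
    by (subst sum.swap, rule sum.cong[OF refl], subst sum.swap, rule sum.cong[OF refl],
        subst sum.swap, rule sum.cong[OF refl], rule sum.swap)
  finally show "quartic_form T (b, c) = contraction_energy T (b, c)"
    by (simp add: quartic_form_def contraction_energy_def tensor_M_def sum_distrib_left sum_distrib_right mult_ac)
qed

lemma ls_functional_expand:
  "ls_functional T (a, b, c) =
     ((norm T)\<^sup>2 - 2 * (contract1 T b c \<bullet> a) + (norm a)\<^sup>2 * (norm b)\<^sup>2 * (norm c)\<^sup>2) / 2"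
proof -
  have 1: "T \<bullet> outer3 a b c = contract1 T b c \<bullet> a"
    by (simp add: inner_vec_def outer3_def contract1_def sum_distrib_left sum_distrib_right mult_ac)
  have 2: "outer3 a b c \<bullet> outer3 a b c = (a \<bullet> a) * (b \<bullet> b) * (c \<bullet> c)"
    by (simp add: inner_vec_def outer3_def sum_product sum_distrib_left sum_distrib_right mult_ac)
  show ?thesis
    unfolding ls_functional_def prod.case power2_norm_eq_inner 2[symmetric] 1[symmetric]
    by (simp add: inner_diff_left inner_diff_right inner_commute)
qed

lemma als_step_fixed:
  assumes "norm b = 1" "norm c = 1" "contract1 T b c = a" "a \<noteq> 0"
    and "contract2 T a c = (norm a)\<^sup>2 *\<^sub>R b" "contract3 T a b = (norm a)\<^sup>2 *\<^sub>R c"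
  shows "als_step T (a, b, c) = (a, b, c)"
  using assms by (simp add: als_step_def Let_def)

lemma als_seq_constant:
  assumes "als_step T x = x"
  shows "als_seq T x n = x"
  using assms by (induction n) (simp_all add: als_seq_def)

lemma not_local_max_ls_functional:
  assumes "a \<noteq> 0" "b \<noteq> 0" "c \<noteq> 0"
  shows "\<not> local_max (ls_functional T) (a, b, c)"
proof
  assume max: "local_max (ls_functional T) (a, b, c)"
  define l m where "l = contract1 T b c \<bullet> a" and "m = (norm a)\<^sup>2 * (norm b)\<^sup>2 * (norm c)\<^sup>2"
  have m: "m > 0" using assms by (simp add: m_def)
  have F: "ls_functional T (t *\<^sub>R a, b, c) = ((norm T)\<^sup>2 - 2 * t * l + t\<^sup>2 * m) / 2" for t
    by (simp add: ls_functional_expand l_def m_def power_mult_distrib)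
  have ev: "\<forall>\<^sub>F t in nhds 1. ls_functional T (t *\<^sub>R a, b, c) \<le> ls_functional T (1 *\<^sub>R a, b, c)"
  proof -
    have "((\<lambda>t. (t *\<^sub>R a, b, c)) \<longlongrightarrow> (1 *\<^sub>R a, b, c)) (nhds 1)"
      by (intro tendsto_intros filterlim_ident)
    then show ?thesis
      using max unfolding local_max_def by (auto dest: eventually_compose_filterlim)
  qed
  then obtain e where e: "e > 0" "\<And>t. dist t 1 < e \<Longrightarrow> - 2 * t * l + t\<^sup>2 * m \<le> - 2 * l + m"
    unfolding eventually_nhds_metric F by force
  have "- 2 * (1 + e / 2) * l + (1 + e / 2)\<^sup>2 * m \<le> - 2 * l + m"
    "- 2 * (1 - e / 2) * l + (1 - e / 2)\<^sup>2 * m \<le> - 2 * l + m"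
    using e(1) by (intro e(2); simp add: dist_real_def)+
  then have "e\<^sup>2 * m \<le> 0" by (simp add: power2_eq_square algebra_simps)
  moreover have "0 < e\<^sup>2 * m" using e(1) m by simp
  ultimately show False by simp
qed

lemma not_local_min_ls_functional:
  assumes bc: "(b, c) \<in> sphere_prod"
    and up: "\<And>e. e > 0 \<Longrightarrow> \<exists>q\<in>sphere_prod. dist q (b, c) < e \<and> quartic_form T (b, c) < quartic_form T q"
  shows "\<not> local_min (ls_functional T) (contract1 T b c, b, c)"
proof
  assume min: "local_min (ls_functional T) (contract1 T b c, b, c)"
  define G where "G q = (contract1 T (fst q) (snd q), q)" for q
  have val: "ls_functional T (G q) = ((norm T)\<^sup>2 - quartic_form T q) / 2" if "q \<in> sphere_prod" for q
  proof (cases q)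
    case (Pair x y)
    then have "norm x = 1" "norm y = 1" using that by (auto simp: sphere_prod_def)
    then show ?thesis
      by (simp add: G_def Pair ls_functional_expand quartic_form_energy contraction_energy_def
          power2_norm_eq_inner)
  qed
  have "isCont G (b, c)"
    unfolding G_def by (intro continuous_intros bounded_bilinear.continuous[OF bounded_bilinear_contract(1)])
  then have "filterlim G (nhds (G (b, c))) (nhds (b, c))"
    unfolding isCont_def tendsto_nhds_iff by simp
  then have "\<forall>\<^sub>F q in nhds (b, c). ls_functional T (G (b, c)) \<le> ls_functional T (G q)"
    using min unfolding local_min_def by (auto simp: G_def dest: eventually_compose_filterlim)
  then obtain e where e: "e > 0" "\<And>q. dist q (b, c) < e \<Longrightarrow> ls_functional T (G (b, c)) \<le> ls_functional T (G q)"
    unfolding eventually_nhds_metric by blast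
  from up[OF e(1)] obtain q where "q \<in> sphere_prod" "dist q (b, c) < e" "quartic_form T (b, c) < quartic_form T q"
    by blast
  with e(2)[of q] val[of q] val[OF bc] show False by simp
qed

theorem theorem3p12:
  fixes T :: "('i::finite, 'j::finite, 'k::finite) tensor"
  assumes dim: "CARD('j) + CARD('k) \<ge> 4"
    and nondeg: "\<And>p. extremum_on (quartic_form T) sphere_prod p \<Longrightarrow>
                   hessian_nonsingular (quartic_form T) p"
  shows "\<exists>(a :: real ^ 'i) (b :: real ^ 'j) (c :: real ^ 'k).
           a \<noteq> 0 \<and> b \<noteq> 0 \<and> c \<noteq> 0 \<and>
           \<not> local_max (ls_functional T) (a, b, c) \<and>
           \<not> local_min (ls_functional T) (a, b, c) \<and>
           (\<forall>n. als_seq T (a, b, c) (Suc n) = als_seq T (a, b, c) n)"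
proof -
  have "DIM(real ^ 'j) + DIM(real ^ 'k) \<ge> 4" using dim by simp
  from trilinear_contractions.positive_saddle_exists[OF trilinear_contractions_contract[of T] this]
  obtain b c where bc: "(b, c) \<in> sphere_prod" "0 < contraction_energy T (b, c)"
    and crit: "contract2 T (contract1 T b c) c = contraction_energy T (b, c) *\<^sub>R b"
      "contract3 T (contract1 T b c) b = contraction_energy T (b, c) *\<^sub>R c"
    and up: "\<forall>e>0. \<exists>q\<in>sphere_prod. dist q (b, c) < e \<and> contraction_energy T (b, c) < contraction_energy T q"
    using nondeg unfolding quartic_form_energy by blast
  have n: "norm b = 1" "norm c = 1" using bc(1) by (auto simp: sphere_prod_def)
  define a where "a = contract1 T b c"
  have en: "contraction_energy T (b, c) = (norm a)\<^sup>2" by (simp add: contraction_energy_def a_def)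
  have nz: "a \<noteq> 0" "b \<noteq> 0" "c \<noteq> 0" using bc(2) n unfolding en by auto
  have "als_step T (a, b, c) = (a, b, c)"
    using als_step_fixed[OF n _ nz(1)] crit unfolding en by (simp add: a_def)
  then have "als_seq T (a, b, c) (Suc n) = als_seq T (a, b, c) n" for n
    using als_seq_constant by metis
  moreover have "\<not> local_min (ls_functional T) (a, b, c)"
    unfolding a_def using not_local_min_ls_functional[OF bc(1)] up unfolding quartic_form_energy by blast
  ultimately show ?thesis using nz not_local_max_ls_functional[OF nz] by blast
qed

end
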